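(* Let $R:=\mathbb{F}_2[X,Y]/(X^2,Y^2)$, and let $x,y$ denote the residue classes of $X,Y$ in $R$. There is a derivation $D:R\to R$ such that, writing $\mathcal{B}:=\mathcal{B}_{D}$ for the maximally differential ideal of $R$ with respect to $\{D\}$, the following hold: (i) $\mathcal{B}=(x,y)$; (ii) $\mathcal{B}$ is a totally reflexive $R$-module, i.e., $T_\bullet:=\big(0\to \mathcal{B}\xrightarrow{\ \mathrm{id}\ }\mathcal{B}\to 0\big)$ is a minimal $G$-resolution of $\mathcal{B}$; (iii) the complex $F^n(T_\bullet)$ is acyclic for all $n\ge 1$; (iv) $\mathcal{B}$ is not a complete intersection ideal. Moreover, there is a derivation $D':R\to R$ such that $\mathcal{B}_{D'}=(x)$.
   Context: All rings are commutative and noetherian. A derivation of $R$ is an additive map $D:R\to R$ with $D(ab)=aD(b)+bD(a)$. For a nonempty set $\mathcal{D}$ of derivations, an ideal $I$ is $\mathcal{D}$-differential if $D(I)\subseteq I$ for all $D\in\mathcal{D}$. If $R$ is local, there is exactly one proper $\mathcal{D}$-differential ideal that is maximal with respect to inclusion among proper $\mathcal{D}$-differential ideals; it is denoted $\mathcal{B}_{\mathcal{D}}$ (and $\mathcal{B}_D$ if $\mathcal{D}=\{D\}$) and called the maximally differential ideal with respect to $\mathcal{D}$. An ideal $\mathfrak{a}$ is a complete intersection if either $\mathfrak{a}=0$ or $\mathfrak{a}$ can be generated by an $R$-regular sequence. Write $(-)^*=\operatorname{Hom}_R(-,R)$. An $R$-module $M$ is totally reflexive if the natural map $M\to M^{**}$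 is an isomorphism and $\operatorname{Ext}^i_R(M,R)=\operatorname{Ext}^i_R(M^*,R)=0$ for all $i\ge1$. The Gorenstein dimension of $M$ is the infimum of all $n\ge 0$ for which there is an exact sequence $0\to G_n\to\cdots\to G_0\to M\to 0$ with every $G_i$ totally reflexive; such a resolution is called a minimal $G$-resolution of $M$. For $R$ of prime characteristic $p$, ${}^nR$ denotes $R$ viewed as an $R$-module via the $n$-th iterate of the Frobenius map, and $F^n(M)=M\otimes_R {}^nR$ is the Peskine–Szpiro functor; $F^n(T_\bullet)$ is obtained by applying it to the complex $T_\bullet$ termwise. *)

theory Defs
  imports
    "HOL-Library.Z2"
    "HOL-Library.Extended_Nat"
    "HOL-Computational_Algebra.Polynomial"
    "HOL-Algebra.Algebra"
    "HOL-Algebra.Algebraic_Closure_Type"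
begin

definition derivation :: "('r, 'a) ring_scheme \<Rightarrow> ('r \<Rightarrow> 'r) \<Rightarrow> bool" where
  "derivation R D \<longleftrightarrow>
     D \<in> carrier R \<rightarrow> carrier R \<and>
     (\<forall>a\<in>carrier R. \<forall>b\<in>carrier R. D (a \<oplus>\<^bsub>R\<^esub> b) = D a \<oplus>\<^bsub>R\<^esub> D b) \<and>
     (\<forall>a\<in>carrier R. \<forall>b\<in>carrier R.
        D (a \<otimes>\<^bsub>R\<^esub> b) = (a \<otimes>\<^bsub>R\<^esub> D b) \<oplus>\<^bsub>R\<^esub> (b \<otimes>\<^bsub>R\<^esub> D a))"

definition differential_ideal ::
    "('r, 'a) ring_scheme \<Rightarrow> ('r \<Rightarrow> 'r) set \<Rightarrow> 'r set \<Rightarrow> bool" where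
  "differential_ideal R \<D> I \<longleftrightarrow> ideal I R \<and> (\<forall>D\<in>\<D>. D ` I \<subseteq> I)"

definition maximal_proper_differential_ideal ::
    "('r, 'a) ring_scheme \<Rightarrow> ('r \<Rightarrow> 'r) set \<Rightarrow> 'r set \<Rightarrow> bool" where
  "maximal_proper_differential_ideal R \<D> I \<longleftrightarrow>
     differential_ideal R \<D> I \<and> I \<noteq> carrier R \<and>
     (\<forall>J. differential_ideal R \<D> J \<and> J \<noteq> carrier R \<and> I \<subseteq> J \<longrightarrow> J = I)"

definition maximally_differential_ideal ::
    "('r, 'a) ring_scheme \<Rightarrow> ('r \<Rightarrow> 'r) set \<Rightarrow> 'r set" where
  "maximally_differential_ideal R \<D> = (THE I. maximal_proper_differential_ideal R \<D> I)"

text \<open>The middle condition says that \<open>as ! i\<close> is a non-zero-divisor on the quotient of \<open>R\<close>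
  by the ideal generated by the preceding entries.\<close>

definition regular_sequence :: "('r, 'a) ring_scheme \<Rightarrow> 'r list \<Rightarrow> bool" where
  "regular_sequence R as \<longleftrightarrow>
     set as \<subseteq> carrier R \<and>
     (\<forall>i<length as. \<forall>r\<in>carrier R.
        (as ! i) \<otimes>\<^bsub>R\<^esub> r \<in> genideal R (set (take i as)) \<longrightarrow> r \<in> genideal R (set (take i as))) \<and>
     genideal R (set as) \<noteq> carrier R"

definition complete_intersection_ideal :: "('r, 'a) ring_scheme \<Rightarrow> 'r set \<Rightarrow> bool" where
  "complete_intersection_ideal R I \<longleftrightarrow>
     I = {\<zero>\<^bsub>R\<^esub>} \<or> (\<exists>as. regular_sequence R as \<and> I = genideal R (set as))"

text \<open>The multiplicative fields of the record underlying a module play no role; they are filled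
  with \<open>undefined\<close> where there is no canonical choice.\<close>

definition ideal_module :: "('r, 'a) ring_scheme \<Rightarrow> 'r set \<Rightarrow> ('r, 'r) module" where
  "ideal_module R I =
     \<lparr>carrier = I, monoid.mult = monoid.mult R, one = \<one>\<^bsub>R\<^esub>,
      ring.zero = \<zero>\<^bsub>R\<^esub>, ring.add = ring.add R, module.smult = monoid.mult R\<rparr>"

definition self_module :: "('r, 'a) ring_scheme \<Rightarrow> ('r, 'r) module" where
  "self_module R = ideal_module R (carrier R)"

definition linear_map ::
    "('r, 'a) ring_scheme \<Rightarrow> ('r, 'm) module \<Rightarrow> ('r, 'n) module \<Rightarrow> ('m \<Rightarrow> 'n) \<Rightarrow> bool" where
  "linear_map R M N f \<longleftrightarrow>
     f \<in> carrier M \<rightarrow> carrier N \<and>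
     (\<forall>x\<in>carrier M. \<forall>y\<in>carrier M. f (x \<oplus>\<^bsub>M\<^esub> y) = f x \<oplus>\<^bsub>N\<^esub> f y) \<and>
     (\<forall>r\<in>carrier R. \<forall>x\<in>carrier M. f (r \<odot>\<^bsub>M\<^esub> x) = r \<odot>\<^bsub>N\<^esub> f x)"

definition module_iso ::
    "('r, 'a) ring_scheme \<Rightarrow> ('r, 'm) module \<Rightarrow> ('r, 'n) module \<Rightarrow> ('m \<Rightarrow> 'n) \<Rightarrow> bool" where
  "module_iso R M N f \<longleftrightarrow> linear_map R M N f \<and> bij_betw f (carrier M) (carrier N)"

definition isomorphic_modules ::
    "('r, 'a) ring_scheme \<Rightarrow> ('r, 'm) module \<Rightarrow> ('r, 'n) module \<Rightarrow> bool" where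
  "isomorphic_modules R M N \<longleftrightarrow> (\<exists>f. module_iso R M N f)"

definition Hom_module ::
    "('r, 'a) ring_scheme \<Rightarrow> ('r, 'm) module \<Rightarrow> ('r, 'n) module \<Rightarrow> ('r, 'm \<Rightarrow> 'n) module" where
  "Hom_module R M N =
     \<lparr>carrier = {f \<in> extensional (carrier M). linear_map R M N f},
      monoid.mult = undefined, one = undefined,
      ring.zero = (\<lambda>x\<in>carrier M. \<zero>\<^bsub>N\<^esub>),
      ring.add = (\<lambda>f g. \<lambda>x\<in>carrier M. f x \<oplus>\<^bsub>N\<^esub> g x),
      module.smult = (\<lambda>r f. \<lambda>x\<in>carrier M. r \<odot>\<^bsub>N\<^esub> f x)\<rparr>"

definition dual_module ::
    "('r, 'a) ring_scheme \<Rightarrow> ('r, 'm) module \<Rightarrow> ('r, 'm \<Rightarrow> 'r) module" where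
  "dual_module R M = Hom_module R M (self_module R)"

definition biduality_map ::
    "('r, 'a) ring_scheme \<Rightarrow> ('r, 'm) module \<Rightarrow> 'm \<Rightarrow> ('m \<Rightarrow> 'r) \<Rightarrow> 'r" where
  "biduality_map R M m = (\<lambda>f\<in>carrier (dual_module R M). f m)"

definition free_module :: "('r, 'a) ring_scheme \<Rightarrow> 'i set \<Rightarrow> ('r, 'i \<Rightarrow> 'r) module" where
  "free_module R S =
     \<lparr>carrier = {c. (\<forall>i. c i \<in> carrier R) \<and> {i. c i \<noteq> \<zero>\<^bsub>R\<^esub>} \<subseteq> S \<and> finite {i. c i \<noteq> \<zero>\<^bsub>R\<^esub>}},
      monoid.mult = undefined, one = undefined,
      ring.zero = (\<lambda>i. \<zero>\<^bsub>R\<^esub>),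
      ring.add = (\<lambda>b c i. b i \<oplus>\<^bsub>R\<^esub> c i),
      module.smult = (\<lambda>r c i. r \<otimes>\<^bsub>R\<^esub> c i)\<rparr>"

text \<open>The exact sequence \<open>\<dots> \<rightarrow> F\<^sub>2 \<rightarrow> F\<^sub>1 \<rightarrow> F\<^sub>0 \<rightarrow> M \<rightarrow> 0\<close> with \<open>F\<^sub>j\<close> free on \<open>S j\<close>, differentials
  \<open>d j : F\<^sub>j\<^sub>+\<^sub>1 \<rightarrow> F\<^sub>j\<close> and augmentation \<open>e\<close>.\<close>

definition free_resolution ::
    "('r, 'a) ring_scheme \<Rightarrow> ('r, 'm) module \<Rightarrow> (nat \<Rightarrow> 'i set) \<Rightarrow>
     (nat \<Rightarrow> ('i \<Rightarrow> 'r) \<Rightarrow> 'i \<Rightarrow> 'r) \<Rightarrow> (('i \<Rightarrow> 'r) \<Rightarrow> 'm) \<Rightarrow> bool" where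
  "free_resolution R M S d e \<longleftrightarrow>
     linear_map R (free_module R (S 0)) M e \<and>
     (\<forall>j. linear_map R (free_module R (S (Suc j))) (free_module R (S j)) (d j)) \<and>
     e ` carrier (free_module R (S 0)) = carrier M \<and>
     d 0 ` carrier (free_module R (S 1)) =
       {c \<in> carrier (free_module R (S 0)). e c = \<zero>\<^bsub>M\<^esub>} \<and>
     (\<forall>j. d (Suc j) ` carrier (free_module R (S (Suc (Suc j)))) =
       {c \<in> carrier (free_module R (S (Suc j))). d j c = \<zero>\<^bsub>free_module R (S j)\<^esub>})"

definition Ext_coboundary ::
    "('r, 'a) ring_scheme \<Rightarrow> (nat \<Rightarrow> 'i set) \<Rightarrow> (nat \<Rightarrow> ('i \<Rightarrow> 'r) \<Rightarrow> 'i \<Rightarrow> 'r) \<Rightarrow> nat \<Rightarrow>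
     (('i \<Rightarrow> 'r) \<Rightarrow> 'n) \<Rightarrow> ('i \<Rightarrow> 'r) \<Rightarrow> 'n" where
  "Ext_coboundary R S d j f = (\<lambda>c\<in>carrier (free_module R (S (Suc j))). f (d j c))"

text \<open>The cohomology, as an abelian group, of \<open>Hom (F\<^sub>\<bullet>, N)\<close> in degree \<open>i\<close>.\<close>

definition Ext_of_resolution ::
    "('r, 'a) ring_scheme \<Rightarrow> (nat \<Rightarrow> 'i set) \<Rightarrow> (nat \<Rightarrow> ('i \<Rightarrow> 'r) \<Rightarrow> 'i \<Rightarrow> 'r) \<Rightarrow> nat \<Rightarrow>
     ('r, 'n) module \<Rightarrow> (('i \<Rightarrow> 'r) \<Rightarrow> 'n) set monoid" where
  "Ext_of_resolution R S d i N =
     (let H = (\<lambda>j. Hom_module R (free_module R (S j)) N);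
          cocycles = {f \<in> carrier (H i). Ext_coboundary R S d i f = \<zero>\<^bsub>H (Suc i)\<^esub>};
          coboundaries = (case i of 0 \<Rightarrow> {\<zero>\<^bsub>H 0\<^esub>}
                          | Suc k \<Rightarrow> Ext_coboundary R S d k ` carrier (H k))
      in \<lparr>carrier = cocycles, monoid.mult = ring.add (H i), one = \<zero>\<^bsub>H i\<^esub>\<rparr> Mod coboundaries)"

text \<open>The resolution is a chosen one with bases in \<open>('m + 'r) list\<close>: this type is infinite and
  at least as large as \<open>M\<close> and \<open>R\<close>, so every \<open>R\<close>-module \<open>M\<close> has a free resolution of this kind.\<close>

definition Ext ::
    "('r, 'a) ring_scheme \<Rightarrow> nat \<Rightarrow> ('r, 'm) module \<Rightarrow> ('r, 'n) module \<Rightarrow>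
     ((('m + 'r) list \<Rightarrow> 'r) \<Rightarrow> 'n) set monoid" where
  "Ext R i M N =
     (let (S, d) = (SOME (S, d). \<exists>e. free_resolution R M S d e)
      in Ext_of_resolution R S d i N)"

definition totally_reflexive :: "('r, 'a) ring_scheme \<Rightarrow> ('r, 'm) module \<Rightarrow> bool" where
  "totally_reflexive R M \<longleftrightarrow>
     module R M \<and>
     module_iso R M (dual_module R (dual_module R M)) (biduality_map R M) \<and>
     (\<forall>i\<ge>1. trivial_group (Ext R i M (self_module R)) \<and>
             trivial_group (Ext R i (dual_module R M) (self_module R)))"

text \<open>A complex \<open>\<dots> \<rightarrow> obj T 2 \<rightarrow> obj T 1 \<rightarrow> obj T 0 \<rightarrow> 0\<close>, with \<open>diff T j : obj T (j+1) \<rightarrow> obj T j\<close>.\<close>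

record ('r, 'm) complex_of_modules =
  obj :: "nat \<Rightarrow> ('r, 'm) module"
  diff :: "nat \<Rightarrow> 'm \<Rightarrow> 'm"

definition complex_of_R_modules ::
    "('r, 'a) ring_scheme \<Rightarrow> ('r, 'm) complex_of_modules \<Rightarrow> bool" where
  "complex_of_R_modules R T \<longleftrightarrow>
     (\<forall>j. module R (obj T j) \<and> linear_map R (obj T (Suc j)) (obj T j) (diff T j) \<and>
        (\<forall>x\<in>carrier (obj T (Suc (Suc j))). diff T j (diff T (Suc j) x) = \<zero>\<^bsub>obj T j\<^esub>))"

definition acyclic_complex ::
    "('r, 'a) ring_scheme \<Rightarrow> ('r, 'm) complex_of_modules \<Rightarrow> bool" where
  "acyclic_complex R T \<longleftrightarrow>
     complex_of_R_modules R T \<and>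
     diff T 0 ` carrier (obj T 1) = carrier (obj T 0) \<and>
     (\<forall>j. diff T (Suc j) ` carrier (obj T (Suc (Suc j))) =
        {x \<in> carrier (obj T (Suc j)). diff T j x = \<zero>\<^bsub>obj T j\<^esub>})"

text \<open>The complex \<open>T\<close> is an exact sequence \<open>0 \<rightarrow> G\<^sub>n \<rightarrow> \<dots> \<rightarrow> G\<^sub>0 \<rightarrow> M \<rightarrow> 0\<close> with all \<open>G\<^sub>i\<close> totally
  reflexive.  The augmentation is part of the complex, so \<open>M = obj T 0\<close> and \<open>G\<^sub>i = obj T (i+1)\<close>.\<close>

definition G_resolution ::
    "('r, 'a) ring_scheme \<Rightarrow> nat \<Rightarrow> ('r, 'm) complex_of_modules \<Rightarrow> bool" where
  "G_resolution R n T \<longleftrightarrow>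
     acyclic_complex R T \<and>
     (\<forall>i\<le>n. totally_reflexive R (obj T (Suc i))) \<and>
     (\<forall>j>Suc n. carrier (obj T j) = {\<zero>\<^bsub>obj T j\<^esub>})"

text \<open>The resolutions are taken with terms in \<open>('m + 'r) list\<close>, which contains isomorphic copies
  of all \<open>R\<close>-modules of cardinality at most \<open>max |M| |R| \<aleph>\<^sub>0\<close>; hence \<open>M\<close> is replaced by a copy.\<close>

definition G_dim :: "('r, 'a) ring_scheme \<Rightarrow> ('r, 'm) module \<Rightarrow> enat" where
  "G_dim R M = Inf {enat n |n. \<exists>T :: ('r, ('m + 'r) list) complex_of_modules.
     isomorphic_modules R (obj T 0) M \<and> G_resolution R n T}"

definition minimal_G_resolution ::
    "('r, 'a) ring_scheme \<Rightarrow> ('r, 'm) module \<Rightarrow> ('r, 'm) complex_of_modules \<Rightarrow> bool" where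
  "minimal_G_resolution R M T \<longleftrightarrow>
     obj T 0 = M \<and> (\<exists>n. G_resolution R n T \<and> enat n = G_dim R M)"

definition identity_complex :: "('r, 'm) module \<Rightarrow> ('r, 'm) complex_of_modules" where
  "identity_complex M =
     \<lparr>obj = (\<lambda>j. if j \<le> 1 then M else M\<lparr>carrier := {\<zero>\<^bsub>M\<^esub>}\<rparr>),
      diff = (\<lambda>j x. if j = 0 then x else \<zero>\<^bsub>M\<^esub>)\<rparr>"

definition tensor_relators ::
    "('r, 'a) ring_scheme \<Rightarrow> ('r, 'm) module \<Rightarrow> ('r, 'n) module \<Rightarrow> ('m \<times> 'n \<Rightarrow>\<^sub>0 int) set" where
  "tensor_relators R M N =
     {frag_of (x \<oplus>\<^bsub>M\<^esub> x', y) - frag_of (x, y) - frag_of (x', y) |x x' y.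
        x \<in> carrier M \<and> x' \<in> carrier M \<and> y \<in> carrier N} \<union>
     {frag_of (x, y \<oplus>\<^bsub>N\<^esub> y') - frag_of (x, y) - frag_of (x, y') |x y y'.
        x \<in> carrier M \<and> y \<in> carrier N \<and> y' \<in> carrier N} \<union>
     {frag_of (r \<odot>\<^bsub>M\<^esub> x, y) - frag_of (x, r \<odot>\<^bsub>N\<^esub> y) |r x y.
        r \<in> carrier R \<and> x \<in> carrier M \<and> y \<in> carrier N}"

definition tensor_relations ::
    "('r, 'a) ring_scheme \<Rightarrow> ('r, 'm) module \<Rightarrow> ('r, 'n) module \<Rightarrow> ('m \<times> 'n \<Rightarrow>\<^sub>0 int) set" where
  "tensor_relations R M N =
     generate (free_Abelian_group (carrier M \<times> carrier N)) (tensor_relators R M N)"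

definition tensor_group ::
    "('r, 'a) ring_scheme \<Rightarrow> ('r, 'm) module \<Rightarrow> ('r, 'n) module \<Rightarrow>
     ('m \<times> 'n \<Rightarrow>\<^sub>0 int) set monoid" where
  "tensor_group R M N =
     free_Abelian_group (carrier M \<times> carrier N) Mod tensor_relations R M N"

text \<open>The map from \<open>M \<otimes> N\<close> to \<open>M' \<otimes> N'\<close> with \<open>x \<otimes> y \<mapsto> f x \<otimes> g y\<close>, on cosets.\<close>

definition tensor_map ::
    "('r, 'a) ring_scheme \<Rightarrow> ('r, 'm') module \<Rightarrow> ('r, 'n') module \<Rightarrow> ('m \<Rightarrow> 'm') \<Rightarrow> ('n \<Rightarrow> 'n') \<Rightarrow>
     ('m \<times> 'n \<Rightarrow>\<^sub>0 int) set \<Rightarrow> ('m' \<times> 'n' \<Rightarrow>\<^sub>0 int) set" where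
  "tensor_map R M' N' f g C =
     (\<Union>c\<in>C. tensor_relations R M' N' #>\<^bsub>free_Abelian_group (carrier M' \<times> carrier N')\<^esub>
        frag_extend (\<lambda>(x, y). frag_of (f x, g y)) c)"

definition frobenius_module ::
    "nat \<Rightarrow> nat \<Rightarrow> ('r, 'a) ring_scheme \<Rightarrow> ('r, 'r) module" where
  "frobenius_module p n R =
     (self_module R)\<lparr>module.smult := (\<lambda>a s. (a [^]\<^bsub>R\<^esub> (p ^ n)) \<otimes>\<^bsub>R\<^esub> s)\<rparr>"

text \<open>The tensor product of \<open>M\<close> with \<open>R\<close> viewed as an \<open>R\<close>-module via the \<open>n\<close>-th iterate of the
  Frobenius map.  It is an \<open>R\<close>-module through the ordinary multiplication on the right factor:
  \<open>r (x \<otimes> s) = x \<otimes> r s\<close>.\<close>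

definition frobenius_functor ::
    "nat \<Rightarrow> nat \<Rightarrow> ('r, 'a) ring_scheme \<Rightarrow> ('r, 'm) module \<Rightarrow>
     ('r, ('m \<times> 'r \<Rightarrow>\<^sub>0 int) set) module" where
  "frobenius_functor p n R M =
     (let N = frobenius_module p n R; G = tensor_group R M N
      in \<lparr>carrier = carrier G, monoid.mult = undefined, one = undefined,
          ring.zero = \<one>\<^bsub>G\<^esub>, ring.add = monoid.mult G,
          module.smult = (\<lambda>r. tensor_map R M N id (\<lambda>s. r \<otimes>\<^bsub>R\<^esub> s))\<rparr>)"

definition frobenius_complex ::
    "nat \<Rightarrow> nat \<Rightarrow> ('r, 'a) ring_scheme \<Rightarrow> ('r, 'm) complex_of_modules \<Rightarrow>
     ('r, ('m \<times> 'r \<Rightarrow>\<^sub>0 int) set) complex_of_modules" where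
  "frobenius_complex p n R T =
     \<lparr>obj = (\<lambda>j. frobenius_functor p n R (obj T j)),
      diff = (\<lambda>j. tensor_map R (obj T j) (frobenius_module p n R) (diff T j) id)\<rparr>"

text \<open>Here \<open>\<F>\<^sub>2[X,Y]\<close> is \<open>\<F>\<^sub>2[X][Y]\<close>: the inner polynomial variable is \<open>X\<close>, the outer one \<open>Y\<close>.\<close>

definition poly_X :: "bit poly poly" where "poly_X = [:[:0, 1:]:]"

definition poly_Y :: "bit poly poly" where "poly_Y = [:0, 1:]"

definition F2XY :: "bit poly poly ring" where "F2XY = ring_of_type_algebra"

definition square_ideal :: "bit poly poly set" where
  "square_ideal = genideal F2XY {poly_X\<^sup>2, poly_Y\<^sup>2}"

definition R22 :: "bit poly poly set ring" where
  "R22 = F2XY Quot square_ideal"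

definition res_x :: "bit poly poly set" where
  "res_x = square_ideal +>\<^bsub>F2XY\<^esub> poly_X"

definition res_y :: "bit poly poly set" where
  "res_y = square_ideal +>\<^bsub>F2XY\<^esub> poly_Y"

end

theory Submission
  imports Defs
begin

text \<open>
  The ring \<open>R = \<F>\<^sub>2[X,Y]/(X\<^sup>2,Y\<^sup>2)\<close> has the \<open>\<F>\<^sub>2\<close>-basis \<open>1, x, y, x y\<close> and is local with maximal ideal
  \<open>(x, y)\<close>. For the zero derivation all ideals are differential, so its maximally differential ideal
  is \<open>B = (x, y)\<close>. For \<open>\<partial>/\<partial>y\<close> the ideal \<open>(x)\<close> is differential, and a proper differential ideal cannot
  contain an element with nonzero \<open>y\<close>-coordinate, as its derivative would be a unit; hence \<open>(x)\<close>
  contains all proper differential ideals.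

  Total reflexivity of \<open>B\<close> comes from \<open>R\<close> being self-injective (\<open>R22_self_injective\<close>): taking the
  coordinate at \<open>x y\<close> identifies \<open>Hom\<^sub>R(N, R)\<close> with the additive maps from \<open>N\<close> to \<open>\<F>\<^sub>2\<close>, and those extend
  from subgroups of groups of exponent 2 (\<open>additive_extension\<close>). Self-injectivity makes
  \<open>Ext\<^sup>i(M, R)\<close> vanish for all \<open>i \<ge> 1\<close> and every finite \<open>M\<close>, for whichever free resolution is chosen
  (\<open>Ext_trivial\<close>). It also shows that \<open>B\<^sup>*\<close> is generated by the inclusion of \<open>B\<close> into \<open>R\<close>, so an
  element of \<open>B\<^sup>*\<^sup>*\<close> is determined by one element of \<open>R\<close>, which has to be annihilated by \<open>x y\<close>, that is, to
  lie in \<open>B\<close> (\<open>totally_reflexive_if_iso_max_ideal\<close>). Therefore \<open>0 \<rightarrow> B \<rightarrow> B \<rightarrow> 0\<close> is a resolution by totally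
  reflexive modules of length 0, the least possible.

  The Frobenius functor kills zero modules and preserves identities, so it takes
  this complex to one of the same shape (\<open>acyclic_frobenius_identity_complex\<close>). Finally \<open>B\<close> is nonzero
  and consists of zero divisors, as \<open>x y B = 0\<close>, so no regular sequence generates it.
\<close>

section \<open>Coordinates on the ring\<close>

text \<open>Bits are treated as elements of a field of characteristic 2, not by Boolean operations.\<close>

declare add_bit_eq_xor [simp del] mult_bit_eq_and [simp del]
  minus_bit_def [simp del] uminus_bit_def [simp del]

lemma bit_add_self [simp]: "b + b = 0" for b :: bit
  by (cases b) simp_all

text \<open>The class of \<open>a + b X + c Y + d X Y\<close>. These sixteen classes are pairwise distinct and exhaust
  the ring, so \<open>el\<close> turns every question about the ring into one about four coordinates in
  \<open>\<F>\<^sub>2\<close>.\<close>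

definition el :: "bit \<Rightarrow> bit \<Rightarrow> bit \<Rightarrow> bit \<Rightarrow> bit poly poly set" where
  "el a b c d = square_ideal +>\<^bsub>F2XY\<^esub> [:[:a, b:], [:c, d:]:]"

text \<open>The coefficients of \<open>1\<close>, \<open>X\<close>, \<open>Y\<close>, \<open>X Y\<close>; a polynomial lies in \<open>(X\<^sup>2, Y\<^sup>2)\<close> iff all four
  vanish.\<close>

definition low_coeffs :: "bit poly poly \<Rightarrow> bit \<times> bit \<times> bit \<times> bit" where
  "low_coeffs p = (coeff (coeff p 0) 0, coeff (coeff p 0) 1, coeff (coeff p 1) 0, coeff (coeff p 1) 1)"

lemma cring_F2XY: "cring F2XY"
  unfolding F2XY_def by (rule cring_from_type_algebra)

lemma F2XY_simps [simp]:
  "carrier F2XY = UNIV" "p \<oplus>\<^bsub>F2XY\<^esub> q = p + q" "p \<otimes>\<^bsub>F2XY\<^esub> q = p * q"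
  "\<zero>\<^bsub>F2XY\<^esub> = 0" "\<one>\<^bsub>F2XY\<^esub> = 1"
  by (simp_all add: F2XY_def ring_of_type_algebra_def)

lemma coeff_mult_0_1:
  fixes p q :: "'a::comm_semiring_1 poly"
  shows "coeff (p * q) 0 = coeff p 0 * coeff q 0"
    and "coeff (p * q) (Suc 0) = coeff p 0 * coeff q (Suc 0) + coeff p (Suc 0) * coeff q 0"
  by (simp_all add: coeff_mult)

lemma square_ideal_ideal: "ideal square_ideal F2XY"
  unfolding square_ideal_def
  by (rule ring.genideal_ideal) (use cring_F2XY in \<open>auto simp: cring_def\<close>)

lemma ideal_low_coeffs: "ideal {p. low_coeffs p = (0, 0, 0, 0)} F2XY"
proof (rule idealI)
  show "ring F2XY" using cring_F2XY by (simp add: cring_def)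
  then interpret ring F2XY .
  have inv: "inv\<^bsub>add_monoid F2XY\<^esub> p = - p" for p
    using minus_equality[of "- p" p] by (simp add: a_inv_def)
  show "subgroup {p. low_coeffs p = (0, 0, 0, 0)} (add_monoid F2XY)"
    by (rule group.subgroupI[OF add.is_group])
      (auto simp: low_coeffs_def inv[simplified] intro!: exI[of _ 0])
qed (auto simp: low_coeffs_def coeff_mult_0_1)

lemma eq_low_part_plus:
  fixes p :: "'a::comm_semiring_1 poly"
  shows "\<exists>q. p = [:coeff p 0, coeff p 1:] + [:0, 1:]\<^sup>2 * q"
proof -
  obtain a r where "p = pCons a r" by (cases p)
  moreover obtain b q where "r = pCons b q" by (cases r)
  ultimately have "p = [:coeff p 0, coeff p 1:] + [:0, 1:]\<^sup>2 * q"
    by (simp add: power2_eq_square)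
  then show ?thesis ..
qed

lemma mem_square_ideal_iff: "p \<in> square_ideal \<longleftrightarrow> low_coeffs p = (0, 0, 0, 0)"
proof
  interpret cring F2XY by (rule cring_F2XY)
  assume "p \<in> square_ideal"
  moreover have "square_ideal \<subseteq> {p. low_coeffs p = (0, 0, 0, 0)}"
    unfolding square_ideal_def
    by (rule genideal_minimal[OF ideal_low_coeffs])
      (auto simp: low_coeffs_def poly_X_def poly_Y_def power2_eq_square)
  ultimately show "low_coeffs p = (0, 0, 0, 0)" by auto
next
  assume low: "low_coeffs p = (0, 0, 0, 0)"
  interpret I: ideal square_ideal F2XY by (rule square_ideal_ideal)
  have gen: "poly_X\<^sup>2 \<in> square_ideal" "poly_Y\<^sup>2 \<in> square_ideal"
    using I.genideal_self[of "{poly_X\<^sup>2, poly_Y\<^sup>2}"] by (auto simp: square_ideal_def)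
  obtain r where r: "p = [:coeff p 0, coeff p 1:] + [:0, 1:]\<^sup>2 * r"
    using eq_low_part_plus by blast
  obtain s t where st: "coeff p 0 = [:0, 1:]\<^sup>2 * s" "coeff p 1 = [:0, 1:]\<^sup>2 * t"
    using eq_low_part_plus[of "coeff p 0"] eq_low_part_plus[of "coeff p 1"] low
    by (auto simp: low_coeffs_def)
  have "p = [:s, t:] * poly_X\<^sup>2 + r * poly_Y\<^sup>2"
    using r unfolding st by (simp add: poly_X_def poly_Y_def power2_eq_square mult.commute)
  then show "p \<in> square_ideal"
    using I.I_l_closed[OF gen(1), of "[:s, t:]"] I.I_l_closed[OF gen(2), of r]
      additive_subgroup.a_closed[OF I.additive_subgroup_axioms] by simp
qed

lemma coset_eq_low_coeffs: "square_ideal +>\<^bsub>F2XY\<^esub> p = {q. low_coeffs q = low_coeffs p}"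
proof -
  have "q \<in> square_ideal +>\<^bsub>F2XY\<^esub> p \<longleftrightarrow> q - p \<in> square_ideal" for q
    unfolding a_r_coset_def' by (auto intro: bexI[of _ "q - p"])
  moreover have "low_coeffs (q - p) = (0, 0, 0, 0) \<longleftrightarrow> low_coeffs q = low_coeffs p" for q
    by (simp add: low_coeffs_def)
  ultimately show ?thesis
    by (simp add: mem_square_ideal_iff set_eq_iff)
qed

lemma coset_eq_el:
  "square_ideal +>\<^bsub>F2XY\<^esub> p =
    el (coeff (coeff p 0) 0) (coeff (coeff p 0) 1) (coeff (coeff p 1) 0) (coeff (coeff p 1) 1)"
  by (simp add: el_def coset_eq_low_coeffs low_coeffs_def)

lemma el_inject [simp]: "el a b c d = el a' b' c' d' \<longleftrightarrow> a = a' \<and> b = b' \<and> c = c' \<and> d = d'"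
proof
  assume "el a b c d = el a' b' c' d'"
  moreover have "[:[:a, b:], [:c, d:]:] \<in> el a b c d"
    by (simp add: el_def coset_eq_low_coeffs)
  ultimately show "a = a' \<and> b = b' \<and> c = c' \<and> d = d'"
    by (auto simp: el_def coset_eq_low_coeffs low_coeffs_def)
qed simp

lemma carrier_R22: "carrier R22 = {el a b c d |a b c d. True}"
proof -
  have "carrier R22 = range (\<lambda>p. square_ideal +>\<^bsub>F2XY\<^esub> p)"
    by (auto simp: R22_def FactRing_def A_RCOSETS_def')
  also have "\<dots> = {el a b c d |a b c d. True}"
  proof
    show "range (\<lambda>p. square_ideal +>\<^bsub>F2XY\<^esub> p) \<subseteq> {el a b c d |a b c d. True}"
      using coset_eq_el by blast
    show "{el a b c d |a b c d. True} \<subseteq> range (\<lambda>p. square_ideal +>\<^bsub>F2XY\<^esub> p)"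
      unfolding el_def by blast
  qed
  finally show ?thesis .
qed

lemma el_closed [simp]: "el a b c d \<in> carrier R22"
  unfolding carrier_R22 by blast

lemma R22_cases:
  assumes "r \<in> carrier R22"
  obtains a b c d where "r = el a b c d"
  using assms unfolding carrier_R22 by blast

lemma el_add [simp]: "el a b c d \<oplus>\<^bsub>R22\<^esub> el a' b' c' d' = el (a + a') (b + b') (c + c') (d + d')"
proof -
  interpret ideal square_ideal F2XY by (rule square_ideal_ideal)
  show ?thesis
    by (simp add: R22_def FactRing_def el_def a_rcos_sum)
qed

lemma el_mult [simp]:
  "el a b c d \<otimes>\<^bsub>R22\<^esub> el a' b' c' d' =
    el (a * a') (a * b' + b * a') (a * c' + c * a') (a * d' + b * c' + c * b' + d * a')"
proof -
  interpret ideal square_ideal F2XY by (rule square_ideal_ideal)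
  have "el a b c d \<otimes>\<^bsub>R22\<^esub> el a' b' c' d' =
      square_ideal +>\<^bsub>F2XY\<^esub> ([:[:a, b:], [:c, d:]:] * [:[:a', b':], [:c', d':]:])"
    unfolding R22_def el_def by (simp add: FactRing_def rcoset_mult_add del: mult_pCons_left mult_pCons_right)
  then show ?thesis
    by (simp only: coset_eq_el coeff_mult_0_1 One_nat_def coeff_pCons_0 coeff_pCons_Suc coeff_add
        add.assoc)
qed

lemma zero_R22: "\<zero>\<^bsub>R22\<^esub> = el 0 0 0 0"
proof -
  have "square_ideal = square_ideal +>\<^bsub>F2XY\<^esub> 0"
    by (auto simp: coset_eq_low_coeffs mem_square_ideal_iff low_coeffs_def)
  then show ?thesis
    by (simp add: R22_def FactRing_def el_def)
qed

lemma one_R22: "\<one>\<^bsub>R22\<^esub> = el 1 0 0 0"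
  by (simp add: R22_def FactRing_def coset_eq_el)

lemma res_x_eq: "res_x = el 0 1 0 0" and res_y_eq: "res_y = el 0 0 1 0"
  by (simp_all add: res_x_def res_y_def coset_eq_el poly_X_def poly_Y_def)

lemma cring_R22: "cring R22"
  unfolding R22_def
  using ideal.quotient_is_cring[OF square_ideal_ideal cring_F2XY] .

lemma finite_carrier_R22: "finite (carrier R22)"
proof -
  have "finite (UNIV :: bit set)" 
  proof (rule finite_subset)
    show "(UNIV :: bit set) \<subseteq> {0, 1}" using bit.exhaust by blast
  qed simp
  then have "finite ((\<lambda>(a, b, c, d). el a b c d) ` (UNIV \<times> UNIV \<times> UNIV \<times> UNIV))"
    by (intro finite_imageI finite_cartesian_product)
  moreover have "carrier R22 \<subseteq> (\<lambda>(a, b, c, d). el a b c d) ` (UNIV \<times> UNIV \<times> UNIV \<times> UNIV)"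
  proof
    fix r assume "r \<in> carrier R22"
    then obtain a b c d where "r = el a b c d" by (rule R22_cases)
    then show "r \<in> (\<lambda>(a, b, c, d). el a b c d) ` (UNIV \<times> UNIV \<times> UNIV \<times> UNIV)"
      by (auto intro!: image_eqI[of _ _ "(a, b, c, d)"])
  qed
  ultimately show ?thesis by (rule rev_finite_subset)
qed

lemma el_uminus: "\<ominus>\<^bsub>R22\<^esub> (el a b c d) = el a b c d"
proof -
  interpret cring R22 by (rule cring_R22)
  show ?thesis by (rule minus_equality) (auto simp: zero_R22)
qed

text \<open>The coordinate at \<open>x y\<close>. The socle of the ring is spanned by \<open>x y\<close>, and composition with this
  functional identifies linear maps into the ring with additive maps into \<open>\<F>\<^sub>2\<close>.\<close>

definition socle_coeff :: "bit poly poly set \<Rightarrow> bit" where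
  "socle_coeff r = (THE d. \<exists>a b c. r = el a b c d)"

lemma socle_coeff_el [simp]: "socle_coeff (el a b c d) = d"
  by (auto simp: socle_coeff_def)

section \<open>Ideals and derivations\<close>

lemma bit_add_left_cancel_self [simp]: "b + (b + c) = c" for b c :: bit
  by (simp flip: add.assoc)

text \<open>The maximal ideal \<open>(x, y)\<close>, consisting of the elements with vanishing constant coordinate.\<close>

abbreviation (input) "max_ideal \<equiv> genideal R22 {res_x, res_y}"

lemma ideal_generated_by_x_y: "max_ideal = {el 0 b c d |b c d. True}"
proof -
  interpret cring R22 by (rule cring_R22)
  have ideal: "ideal {el 0 b c d |b c d. True} R22"
  proof (rule idealI)
    show "subgroup {el 0 b c d |b c d. True} (add_monoid R22)"
      by (rule add.subgroupI) (auto simp: el_uminus simp flip: a_inv_def)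
  qed (auto elim!: R22_cases simp: ring_axioms)
  show ?thesis
  proof
    show "max_ideal \<subseteq> {el 0 b c d |b c d. True}"
      by (rule genideal_minimal[OF ideal]) (auto simp: res_x_eq res_y_eq)
    interpret I: ideal "max_ideal" R22
      by (rule genideal_ideal) (auto simp: res_x_eq res_y_eq)
    have gen: "res_x \<in> max_ideal" "res_y \<in> max_ideal"
      using genideal_self[of "{res_x, res_y}"] by (auto simp: res_x_eq res_y_eq)
    have "el b 0 d 0 \<otimes>\<^bsub>R22\<^esub> res_x \<oplus>\<^bsub>R22\<^esub> el c 0 0 0 \<otimes>\<^bsub>R22\<^esub> res_y \<in> max_ideal" for b c d
      by (intro I.a_closed I.I_l_closed gen el_closed)
    then show "{el 0 b c d |b c d. True} \<subseteq> max_ideal"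
      by (auto simp: res_x_eq res_y_eq)
  qed
qed

lemma ideal_generated_by_x: "genideal R22 {res_x} = {el 0 b 0 d |b d. True}"
proof -
  interpret cring R22 by (rule cring_R22)
  have ideal: "ideal {el 0 b 0 d |b d. True} R22"
  proof (rule idealI)
    show "subgroup {el 0 b 0 d |b d. True} (add_monoid R22)"
      by (rule add.subgroupI) (auto simp: el_uminus simp flip: a_inv_def)
  qed (auto elim!: R22_cases simp: ring_axioms)
  show ?thesis
  proof
    show "genideal R22 {res_x} \<subseteq> {el 0 b 0 d |b d. True}"
      by (rule genideal_minimal[OF ideal]) (auto simp: res_x_eq)
    interpret I: ideal "genideal R22 {res_x}" R22
      by (rule genideal_ideal) (auto simp: res_x_eq)
    have "el b 0 d 0 \<otimes>\<^bsub>R22\<^esub> res_x \<in> genideal R22 {res_x}" for b d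
      by (intro I.I_l_closed genideal_self' el_closed) (simp add: res_x_eq)
    then show "{el 0 b 0 d |b d. True} \<subseteq> genideal R22 {res_x}"
      by (auto simp: res_x_eq)
  qed
qed

text \<open>An element with constant coordinate 1 is its own inverse, so the ring is local.\<close>

lemma proper_ideal_subset:
  assumes "ideal J R22" "J \<noteq> carrier R22"
  shows "J \<subseteq> {el 0 b c d |b c d. True}"
proof
  interpret ideal J R22 by fact
  fix r assume r: "r \<in> J"
  then obtain a b c d where el: "r = el a b c d"
    using a_subset R22_cases by blast
  have "a = 0"
  proof (rule ccontr)
    assume "a \<noteq> 0"
    then have "r \<otimes>\<^bsub>R22\<^esub> r = \<one>\<^bsub>R22\<^esub>"
      by (simp add: el one_R22 ac_simps)
    then have "\<one>\<^bsub>R22\<^esub> \<in> J"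
      using I_l_closed[OF r] r a_subset by (metis subsetD)
    then show False using one_imp_carrier assms(2) by blast
  qed
  then show "r \<in> {el 0 b c d |b c d. True}" by (auto simp: el)
qed

lemma proper_ideal_generated: 
  "max_ideal \<noteq> carrier R22" "genideal R22 {res_x} \<noteq> carrier R22"
proof -
  have "el 1 0 0 0 \<in> carrier R22" by simp
  moreover have "el 1 0 0 0 \<notin> max_ideal" "el 1 0 0 0 \<notin> genideal R22 {res_x}"
    by (auto simp: ideal_generated_by_x_y ideal_generated_by_x)
  ultimately show "max_ideal \<noteq> carrier R22" "genideal R22 {res_x} \<noteq> carrier R22"
    by metis+
qed

lemma maximally_differential_ideal_eqI:
  assumes "differential_ideal R \<D> I" "I \<noteq> carrier R"
    and "\<And>J. differential_ideal R \<D> J \<Longrightarrow> J \<noteq> carrier R \<Longrightarrow> J \<subseteq> I"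
  shows "maximally_differential_ideal R \<D> = I"
  unfolding maximally_differential_ideal_def
proof (rule the_equality)
  show "maximal_proper_differential_ideal R \<D> I"
    using assms unfolding maximal_proper_differential_ideal_def by blast
next
  fix J assume "maximal_proper_differential_ideal R \<D> J"
  then show "J = I"
    using assms unfolding maximal_proper_differential_ideal_def by blast
qed

lemma derivation_zero:
  assumes "cring R"
  shows "derivation R (\<lambda>_. \<zero>\<^bsub>R\<^esub>)"
proof -
  interpret cring R by fact
  show ?thesis by (auto simp: derivation_def)
qed

lemma maximally_differential_ideal_zero:
  "maximally_differential_ideal R22 {\<lambda>_. \<zero>\<^bsub>R22\<^esub>} = max_ideal"
proof (rule maximally_differential_ideal_eqI)
  interpret cring R22 by (rule cring_R22)
  interpret I: ideal "max_ideal" R22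
    by (rule genideal_ideal) (auto simp: res_x_eq res_y_eq)
  show "differential_ideal R22 {\<lambda>_. \<zero>\<^bsub>R22\<^esub>} (max_ideal)"
    using I.ideal_axioms I.zero_closed by (auto simp: differential_ideal_def)
  show "max_ideal \<noteq> carrier R22"
    by (rule proper_ideal_generated)
next
  fix J assume "differential_ideal R22 {\<lambda>_. \<zero>\<^bsub>R22\<^esub>} J" "J \<noteq> carrier R22"
  then show "J \<subseteq> max_ideal"
    unfolding ideal_generated_by_x_y by (intro proper_ideal_subset) (auto simp: differential_ideal_def)
qed

text \<open>The derivation \<open>\<partial>/\<partial>y\<close>, sending \<open>a + b x + c y + d x y\<close> to \<open>c + d x\<close>.\<close>

definition d_dy :: "bit poly poly set \<Rightarrow> bit poly poly set" where
  "d_dy r = (THE s. \<exists>a b c d. r = el a b c d \<and> s = el c d 0 0)"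

lemma d_dy_el [simp]: "d_dy (el a b c d) = el c d 0 0"
  by (auto simp: d_dy_def)

lemma derivation_d_dy: "derivation R22 d_dy"
  unfolding derivation_def
proof (intro conjI ballI)
  fix r s assume "r \<in> carrier R22" "s \<in> carrier R22"
  then obtain a b c d a' b' c' d' where "r = el a b c d" "s = el a' b' c' d'"
    by (metis R22_cases)
  then show "d_dy (r \<oplus>\<^bsub>R22\<^esub> s) = d_dy r \<oplus>\<^bsub>R22\<^esub> d_dy s"
    "d_dy (r \<otimes>\<^bsub>R22\<^esub> s) = r \<otimes>\<^bsub>R22\<^esub> d_dy s \<oplus>\<^bsub>R22\<^esub> s \<otimes>\<^bsub>R22\<^esub> d_dy r"
    by (simp_all add: ac_simps)
qed (auto elim!: R22_cases)

text \<open>If \<open>b x + c y + d x y\<close> lies in a proper differential ideal then so does its derivative \<open>c + d x\<close>,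
  which is a unit unless \<open>c = 0\<close>.\<close>

lemma maximally_differential_ideal_d_dy:
  "maximally_differential_ideal R22 {d_dy} = genideal R22 {res_x}"
proof (rule maximally_differential_ideal_eqI)
  interpret cring R22 by (rule cring_R22)
  have "ideal (genideal R22 {res_x}) R22"
    by (rule genideal_ideal) (auto simp: res_x_eq)
  then show "differential_ideal R22 {d_dy} (genideal R22 {res_x})"
    unfolding differential_ideal_def by (auto simp: ideal_generated_by_x)
  show "genideal R22 {res_x} \<noteq> carrier R22"
    by (rule proper_ideal_generated)
next
  fix J assume J: "differential_ideal R22 {d_dy} J" "J \<noteq> carrier R22"
  then have sub: "J \<subseteq> {el 0 b c d |b c d. True}"
    by (intro proper_ideal_subset) (auto simp: differential_ideal_def)
  show "J \<subseteq> genideal R22 {res_x}"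
  proof
    fix r assume r: "r \<in> J"
    then obtain b c d where el: "r = el 0 b c d" using sub by blast
    from r J have "d_dy r \<in> J" by (auto simp: differential_ideal_def)
    then have "c = 0" using sub by (auto simp: el)
    then show "r \<in> genideal R22 {res_x}" by (auto simp: ideal_generated_by_x el)
  qed
qed

section \<open>Failure of the complete intersection property\<close>

text \<open>The first member of a regular sequence would be a non-zero-divisor, but \<open>x y\<close> annihilates the whole
  ideal.\<close>

lemma not_complete_intersection:
  "\<not> complete_intersection_ideal R22 (max_ideal)"
proof
  interpret cring R22 by (rule cring_R22)
  assume "complete_intersection_ideal R22 (max_ideal)"
  moreover have ne: "max_ideal \<noteq> {\<zero>\<^bsub>R22\<^esub>}"
  proof -
    have "el 0 1 0 0 \<in> max_ideal"
      unfolding ideal_generated_by_x_y by blast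
    then show ?thesis by (auto simp: zero_R22)
  qed
  ultimately obtain rs where rs: "regular_sequence R22 rs"
    and gen: "max_ideal = genideal R22 (set rs)"
    unfolding complete_intersection_ideal_def by blast
  have zero: "genideal R22 {} = {\<zero>\<^bsub>R22\<^esub>}"
    using genideal_minimal[OF zeroideal, of "{}"] additive_subgroup.zero_closed[OF ideal.axioms(1)[OF genideal_ideal[of "{}"]]]
    by blast
  obtain r rs' where Cons: "rs = r # rs'"
    using gen ne zero by (cases rs) auto
  have "r \<in> genideal R22 (set rs)"
    using rs genideal_self[of "set rs"] by (auto simp: Cons regular_sequence_def)
  then obtain b c d where "r = el 0 b c d"
    unfolding gen[symmetric] ideal_generated_by_x_y by blast
  then have "rs ! 0 \<otimes>\<^bsub>R22\<^esub> el 0 0 0 1 \<in> genideal R22 (set (take 0 rs))"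
    by (simp add: Cons zero zero_R22)
  then have "el 0 0 0 1 \<in> genideal R22 (set (take 0 rs))"
    using rs Cons el_closed unfolding regular_sequence_def by (metis length_greater_0_conv list.distinct(1))
  then show False by (simp add: zero zero_R22)
qed

section \<open>Modules of homomorphisms and free modules\<close>

lemma linear_mapI:
  assumes "\<And>x. x \<in> carrier M \<Longrightarrow> f x \<in> carrier N"
    and "\<And>x y. x \<in> carrier M \<Longrightarrow> y \<in> carrier M \<Longrightarrow> f (x \<oplus>\<^bsub>M\<^esub> y) = f x \<oplus>\<^bsub>N\<^esub> f y"
    and "\<And>r x. r \<in> carrier R \<Longrightarrow> x \<in> carrier M \<Longrightarrow> f (r \<odot>\<^bsub>M\<^esub> x) = r \<odot>\<^bsub>N\<^esub> f x"
  shows "linear_map R M N f"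
  using assms by (auto simp: linear_map_def)

lemma linear_map_closed: "linear_map R M N f \<Longrightarrow> x \<in> carrier M \<Longrightarrow> f x \<in> carrier N"
  and linear_map_add: "linear_map R M N f \<Longrightarrow> x \<in> carrier M \<Longrightarrow> y \<in> carrier M \<Longrightarrow>
    f (x \<oplus>\<^bsub>M\<^esub> y) = f x \<oplus>\<^bsub>N\<^esub> f y"
  and linear_map_smult: "linear_map R M N f \<Longrightarrow> r \<in> carrier R \<Longrightarrow> x \<in> carrier M \<Longrightarrow>
    f (r \<odot>\<^bsub>M\<^esub> x) = r \<odot>\<^bsub>N\<^esub> f x"
  by (auto simp: linear_map_def)

lemma linear_map_zero:
  assumes "module R M" "module R N" "linear_map R M N f"
  shows "f \<zero>\<^bsub>M\<^esub> = \<zero>\<^bsub>N\<^esub>"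
proof -
  interpret M: module R M by fact
  interpret N: module R N by fact
  have "f (\<zero>\<^bsub>R\<^esub> \<odot>\<^bsub>M\<^esub> \<zero>\<^bsub>M\<^esub>) = \<zero>\<^bsub>R\<^esub> \<odot>\<^bsub>N\<^esub> f \<zero>\<^bsub>M\<^esub>"
    using linear_map_smult[OF assms(3)] by blast
  then show ?thesis using linear_map_closed[OF assms(3)] by simp
qed

lemma linear_map_uminus:
  assumes "module R M" "module R N" "linear_map R M N f" "x \<in> carrier M"
  shows "f (\<ominus>\<^bsub>M\<^esub> x) = \<ominus>\<^bsub>N\<^esub> f x"
proof -
  interpret M: module R M by fact
  interpret N: module R N by fact
  have "f (\<ominus>\<^bsub>M\<^esub> x) \<oplus>\<^bsub>N\<^esub> f x = f (\<ominus>\<^bsub>M\<^esub> x \<oplus>\<^bsub>M\<^esub> x)"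
    using linear_map_add[OF assms(3)] assms(4) by simp
  then have "f (\<ominus>\<^bsub>M\<^esub> x) \<oplus>\<^bsub>N\<^esub> f x = \<zero>\<^bsub>N\<^esub>"
    using linear_map_zero[OF assms(1-3)] assms(4) by (simp add: M.l_neg)
  then show ?thesis
    using linear_map_closed[OF assms(3)] assms(4) by (intro N.minus_equality[symmetric]) auto
qed

lemma module_ideal_module:
  assumes "cring R" "ideal I R"
  shows "module R (ideal_module R I)"
proof -
  interpret cring R by fact
  interpret I: ideal I R by fact
  have mem: "x \<in> carrier R" if "x \<in> I" for x
    using that I.a_subset by blast
  show ?thesis
  proof (rule moduleI)
    show "abelian_group (ideal_module R I)"
    proof (rule abelian_groupI)
      fix x assume "x \<in> carrier (ideal_module R I)"
      then show "\<exists>y\<in>carrier (ideal_module R I). y \<oplus>\<^bsub>ideal_module R I\<^esub> x = \<zero>\<^bsub>ideal_module R I\<^esub>"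
        using mem by (auto simp: ideal_module_def l_neg intro!: bexI[of _ "\<ominus>\<^bsub>R\<^esub> x"])
    qed (auto simp: ideal_module_def mem a_ac)
  qed (auto simp: ideal_module_def mem I.I_l_closed l_distr r_distr m_assoc assms)
qed

lemma module_self_module: "cring R \<Longrightarrow> module R (self_module R)"
  unfolding self_module_def
  by (intro module_ideal_module ring.oneideal cring.axioms(1))

lemma self_module_simps [simp]:
  "carrier (self_module R) = carrier R" "\<zero>\<^bsub>self_module R\<^esub> = \<zero>\<^bsub>R\<^esub>"
  "x \<oplus>\<^bsub>self_module R\<^esub> y = x \<oplus>\<^bsub>R\<^esub> y" "r \<odot>\<^bsub>self_module R\<^esub> x = r \<otimes>\<^bsub>R\<^esub> x"
  by (simp_all add: self_module_def ideal_module_def)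

lemma Hom_module_simps:
  "f \<in> carrier (Hom_module R M N) \<longleftrightarrow> f \<in> extensional (carrier M) \<and> linear_map R M N f"
  "\<zero>\<^bsub>Hom_module R M N\<^esub> = (\<lambda>x\<in>carrier M. \<zero>\<^bsub>N\<^esub>)"
  "f \<oplus>\<^bsub>Hom_module R M N\<^esub> g = (\<lambda>x\<in>carrier M. f x \<oplus>\<^bsub>N\<^esub> g x)"
  "r \<odot>\<^bsub>Hom_module R M N\<^esub> f = (\<lambda>x\<in>carrier M. r \<odot>\<^bsub>N\<^esub> f x)"
  by (simp_all add: Hom_module_def)

lemma module_Hom_module:
  assumes "module R M" "module R N"
  shows "module R (Hom_module R M N)"
proof -
  interpret M: module R M by fact
  interpret N: module R N by fact
  note [simp] = linear_map_closed linear_map_add linear_map_smult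
  note simps = Hom_module_simps fun_eq_iff extensional_def restrict_def
  have comm: "r \<odot>\<^bsub>N\<^esub> (s \<odot>\<^bsub>N\<^esub> x) = s \<odot>\<^bsub>N\<^esub> (r \<odot>\<^bsub>N\<^esub> x)"
    if "r \<in> carrier R" "s \<in> carrier R" "x \<in> carrier N" for r s x
    using that by (simp flip: N.smult_assoc1 add: M.m_comm)
  show ?thesis
  proof (rule moduleI)
    show "abelian_group (Hom_module R M N)"
    proof (rule abelian_groupI)
      fix f assume f: "f \<in> carrier (Hom_module R M N)"
      have "(\<lambda>x\<in>carrier M. \<ominus>\<^bsub>N\<^esub> f x) \<in> carrier (Hom_module R M N)"
        using f by (auto simp: Hom_module_simps N.minus_add N.smult_r_minus intro!: linear_mapI)
      then show "\<exists>g\<in>carrier (Hom_module R M N). g \<oplus>\<^bsub>Hom_module R M N\<^esub> f = \<zero>\<^bsub>Hom_module R M N\<^esub>"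
        using f by (intro bexI[of _ "\<lambda>x\<in>carrier M. \<ominus>\<^bsub>N\<^esub> f x"]) (auto simp: simps N.l_neg)
    qed (auto simp: Hom_module_simps fun_eq_iff restrict_def extensional_def N.a_ac intro!: linear_mapI,
         auto simp: N.smult_r_distr)
  qed (auto simp: Hom_module_simps fun_eq_iff restrict_def extensional_def N.a_ac M.cring_axioms
      N.smult_r_distr N.smult_l_distr N.smult_assoc1 comm intro!: linear_mapI M.R.cring_axioms)
qed

lemma free_module_simps:
  "c \<in> carrier (free_module R S) \<longleftrightarrow>
    (\<forall>i. c i \<in> carrier R) \<and> {i. c i \<noteq> \<zero>\<^bsub>R\<^esub>} \<subseteq> S \<and> finite {i. c i \<noteq> \<zero>\<^bsub>R\<^esub>}"
  "\<zero>\<^bsub>free_module R S\<^esub> = (\<lambda>i. \<zero>\<^bsub>R\<^esub>)"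
  "b \<oplus>\<^bsub>free_module R S\<^esub> c = (\<lambda>i. b i \<oplus>\<^bsub>R\<^esub> c i)"
  "r \<odot>\<^bsub>free_module R S\<^esub> c = (\<lambda>i. r \<otimes>\<^bsub>R\<^esub> c i)"
  by (simp_all add: free_module_def)

lemma module_free_module:
  assumes "cring R"
  shows "module R (free_module R S)"
proof -
  interpret cring R by fact
  have supp_add: "{i. b i \<oplus>\<^bsub>R\<^esub> c i \<noteq> \<zero>\<^bsub>R\<^esub>} \<subseteq> {i. b i \<noteq> \<zero>\<^bsub>R\<^esub>} \<union> {i. c i \<noteq> \<zero>\<^bsub>R\<^esub>}" for b c :: "'c \<Rightarrow> 'a"
    by auto
  have supp_smult: "{i. r \<otimes>\<^bsub>R\<^esub> c i \<noteq> \<zero>\<^bsub>R\<^esub>} \<subseteq> {i. c i \<noteq> \<zero>\<^bsub>R\<^esub>}" if "r \<in> carrier R" for r and c :: "'c \<Rightarrow> 'a"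
    using that by auto
  have supp_uminus: "{i. \<ominus>\<^bsub>R\<^esub> c i \<noteq> \<zero>\<^bsub>R\<^esub>} \<subseteq> {i. c i \<noteq> \<zero>\<^bsub>R\<^esub>}" for c :: "'c \<Rightarrow> 'a"
    by auto
  have add: "b \<oplus>\<^bsub>free_module R S\<^esub> c \<in> carrier (free_module R S)"
    if "b \<in> carrier (free_module R S)" "c \<in> carrier (free_module R S)" for b c :: "'c \<Rightarrow> 'a"
    using that finite_subset[OF supp_add[of b c]] supp_add[of b c] by (auto simp: free_module_simps)
  have smult: "r \<odot>\<^bsub>free_module R S\<^esub> c \<in> carrier (free_module R S)"
    if "r \<in> carrier R" "c \<in> carrier (free_module R S)" for r and c :: "'c \<Rightarrow> 'a"
    using that finite_subset[OF supp_smult[of r c]] supp_smult[of r c] by (auto simp: free_module_simps)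
  show ?thesis
  proof (rule moduleI)
    show "abelian_group (free_module R S)"
    proof (rule abelian_groupI)
      fix c :: "'c \<Rightarrow> 'a" assume c: "c \<in> carrier (free_module R S)"
      have "(\<lambda>i. \<ominus>\<^bsub>R\<^esub> c i) \<in> carrier (free_module R S)"
        using c finite_subset[OF supp_uminus[of c]] supp_uminus[of c] by (auto simp: free_module_simps)
      then show "\<exists>b\<in>carrier (free_module R S). b \<oplus>\<^bsub>free_module R S\<^esub> c = \<zero>\<^bsub>free_module R S\<^esub>"
        using c by (intro bexI[of _ "\<lambda>i. \<ominus>\<^bsub>R\<^esub> c i"]) (auto simp: free_module_simps l_neg)
    qed (auto simp: add, auto simp: free_module_simps a_ac)
  qed (auto simp: smult cring_axioms, auto simp: free_module_simps l_distr r_distr m_assoc)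
qed

lemma finite_free_module:
  assumes "finite (carrier R)" "finite S"
  shows "finite (carrier (free_module R S))"
proof (rule finite_subset)
  show "finite {c. \<forall>i. (i \<in> S \<longrightarrow> c i \<in> carrier R) \<and> (i \<notin> S \<longrightarrow> c i = \<zero>\<^bsub>R\<^esub>)}"
    using assms by (intro finite_set_of_finite_funs)
qed (auto simp: free_module_simps)


section \<open>Free resolutions of finite modules\<close>

lemma ex_free_cover:
  assumes "module R M" "finite (carrier M)" "infinite (UNIV :: 'i set)"
  obtains S :: "'i set" and e where "finite S" "linear_map R (free_module R S) M e"
    "e ` carrier (free_module R S) = carrier M"
proof -
  interpret M: module R M by fact
  obtain b :: "_ \<Rightarrow> 'i" where b: "inj_on b (carrier M)"
    using inj_on_iff_card_le infinite_arbitrarily_large[OF assms(3), of "card (carrier M)"] assms(2)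
    by (metis order_refl)
  define S where "S = b ` carrier M"
  define g where "g = inv_into (carrier M) b"
  have g: "g i \<in> carrier M" if "i \<in> S" for i
    using that by (auto simp: g_def S_def inv_into_into)
  have fin: "finite S" using assms(2) by (simp add: S_def)
  define e where "e c = (\<Oplus>\<^bsub>M\<^esub>i\<in>S. c i \<odot>\<^bsub>M\<^esub> g i)" for c
  show thesis
  proof
    show "finite S" by fact
    show lin: "linear_map R (free_module R S) M e"
    proof (rule linear_mapI)
      fix c assume c: "c \<in> carrier (free_module R S)"
      show "e c \<in> carrier M"
        unfolding e_def using c g by (intro M.finsum_closed) (auto simp: free_module_simps)
      fix b assume b: "b \<in> carrier (free_module R S)"
      have "e (b \<oplus>\<^bsub>free_module R S\<^esub> c) = (\<Oplus>\<^bsub>M\<^esub>i\<in>S. b i \<odot>\<^bsub>M\<^esub> g i \<oplus>\<^bsub>M\<^esub> c i \<odot>\<^bsub>M\<^esub> g i)"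
        unfolding e_def using b c g
        by (intro M.finsum_cong') (auto simp: free_module_simps M.smult_l_distr)
      also have "\<dots> = e b \<oplus>\<^bsub>M\<^esub> e c"
        unfolding e_def using b c g by (intro M.finsum_addf) (auto simp: free_module_simps)
      finally show "e (b \<oplus>\<^bsub>free_module R S\<^esub> c) = e b \<oplus>\<^bsub>M\<^esub> e c" .
    next
      fix r c assume r: "r \<in> carrier R" and c: "c \<in> carrier (free_module R S)"
      have "e (r \<odot>\<^bsub>free_module R S\<^esub> c) = (\<Oplus>\<^bsub>M\<^esub>i\<in>S. r \<odot>\<^bsub>M\<^esub> (c i \<odot>\<^bsub>M\<^esub> g i))"
        unfolding e_def using r c g
        by (intro M.finsum_cong') (auto simp: free_module_simps M.smult_assoc1)
      also have "\<dots> = r \<odot>\<^bsub>M\<^esub> e c"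
        unfolding e_def using r c g fin
        by (intro M.finsum_smult_ldistr[symmetric]) (auto simp: free_module_simps)
      finally show "e (r \<odot>\<^bsub>free_module R S\<^esub> c) = r \<odot>\<^bsub>M\<^esub> e c" .
    qed
    show "e ` carrier (free_module R S) = carrier M"
    proof
      show "e ` carrier (free_module R S) \<subseteq> carrier M"
        using linear_map_closed[OF lin] by blast
      show "carrier M \<subseteq> e ` carrier (free_module R S)"
      proof
        fix v assume v: "v \<in> carrier M"
        define c where "c i = (if b v = i then \<one>\<^bsub>R\<^esub> else \<zero>\<^bsub>R\<^esub>)" for i
        have bv: "b v \<in> S" using v by (simp add: S_def)
        have "{i. c i \<noteq> \<zero>\<^bsub>R\<^esub>} \<subseteq> {b v}" by (auto simp: c_def)
        then have "c \<in> carrier (free_module R S)"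
          using bv finite_subset[of "{i. c i \<noteq> \<zero>\<^bsub>R\<^esub>}" "{b v}"]
          by (auto simp: free_module_simps) (auto simp: c_def)
        moreover have "e c = (\<Oplus>\<^bsub>M\<^esub>i\<in>S. if b v = i then g i else \<zero>\<^bsub>M\<^esub>)"
          unfolding e_def using g by (intro M.finsum_cong') (auto simp: c_def)
        moreover have "\<dots> = v"
          using M.finsum_singleton[OF bv fin, of g] g v b by (auto simp: g_def)
        ultimately show "v \<in> e ` carrier (free_module R S)" by force
      qed
    qed
  qed
qed

lemma module_kernel:
  assumes "module R M" "module R N" "linear_map R M N f"
  shows "module R (M\<lparr>carrier := {x \<in> carrier M. f x = \<zero>\<^bsub>N\<^esub>}\<rparr>)"
proof -
  interpret M: module R M by fact
  interpret N: module R N by fact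
  have "submodule {x \<in> carrier M. f x = \<zero>\<^bsub>N\<^esub>} R M"
    using assms by (intro M.submoduleI)
      (auto simp: linear_map_zero linear_map_add linear_map_smult linear_map_uminus)
  then show ?thesis
    using submodule.submodule_is_module assms(1) by blast
qed

lemma ex_free_cover_kernel:
  assumes "module R M" "module R N" "linear_map R M N f" "finite (carrier M)" "infinite (UNIV :: 'i set)"
  obtains S :: "'i set" and d where "finite S" "linear_map R (free_module R S) M d"
    "d ` carrier (free_module R S) = {x \<in> carrier M. f x = \<zero>\<^bsub>N\<^esub>}"
proof -
  let ?K = "M\<lparr>carrier := {x \<in> carrier M. f x = \<zero>\<^bsub>N\<^esub>}\<rparr>"
  obtain S :: "'i set" and d where d: "finite S" "linear_map R (free_module R S) ?K d"
    "d ` carrier (free_module R S) = carrier ?K"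
    using ex_free_cover[OF module_kernel[OF assms(1-3)] _ assms(5)] assms(4) by auto
  then have "linear_map R (free_module R S) M d"
    by (auto simp: linear_map_def)
  then show thesis using that d by simp
qed

text \<open>Over a finite ring all kernels stay finite, so finite bases indexed by any infinite type suffice.\<close>

lemma ex_free_resolution:
  assumes "module R M" "finite (carrier M)" "finite (carrier R)" "infinite (UNIV :: 'i set)"
  shows "\<exists>(S :: nat \<Rightarrow> 'i set) d e. free_resolution R M S d e"
proof -
  interpret M: module R M by fact
  note free = module_free_module[OF M.R.is_cring]
  let ?F = "\<lambda>S :: 'i set. free_module R S"
  obtain S0 :: "'i set" and e where e: "finite S0" "linear_map R (?F S0) M e"
    "e ` carrier (?F S0) = carrier M"
    using ex_free_cover[OF assms(1,2,4)] by blast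
  define P where "P n = (\<lambda>(S, S', d). finite S \<and> finite S' \<and> linear_map R (?F S') (?F S) d \<and>
    (n = 0 \<longrightarrow> S = S0 \<and> d ` carrier (?F S') = {c \<in> carrier (?F S). e c = \<zero>\<^bsub>M\<^esub>}))" for n :: nat
  define Q where "Q = (\<lambda>(S, S', d) (T, T', d'). T = S' \<and>
    d' ` carrier (?F T') = {c \<in> carrier (?F S'). d c = \<zero>\<^bsub>?F S\<^esub>})"
  have "\<exists>t. P 0 t"
  proof -
    obtain S :: "'i set" and d where "finite S" "linear_map R (?F S) (?F S0) d"
      "d ` carrier (?F S) = {x \<in> carrier (?F S0). e x = \<zero>\<^bsub>M\<^esub>}"
      using ex_free_cover_kernel[OF free assms(1) e(2) finite_free_module[OF assms(3) e(1)] assms(4)] .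
    then have "P 0 (S0, S, d)" using e(1) by (simp add: P_def)
    then show ?thesis ..
  qed
  moreover have "\<exists>t'. P (Suc n) t' \<and> Q t t'" if "P n t" for t n
  proof -
    obtain S S' d where t: "t = (S, S', d)" by (cases t)
    have fin: "finite S'" and lin: "linear_map R (?F S') (?F S) d"
      using that by (auto simp: P_def t)
    obtain T :: "'i set" and d' where "finite T" "linear_map R (?F T) (?F S') d'"
      "d' ` carrier (?F T) = {x \<in> carrier (?F S'). d x = \<zero>\<^bsub>?F S\<^esub>}"
      using ex_free_cover_kernel[OF free free lin finite_free_module[OF assms(3) fin] assms(4)] .
    then have "P (Suc n) (S', T, d') \<and> Q t (S', T, d')"
      using fin by (simp add: P_def Q_def t)
    then show ?thesis ..
  qed
  ultimately obtain t where t: "\<And>n. P n (t n)" "\<And>n. Q (t n) (t (Suc n))"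
    using dependent_nat_choice[of P "\<lambda>_. Q"] by metis
  define S where "S n = fst (t n)" for n
  define d where "d n = snd (snd (t n))" for n
  have t_eq: "t n = (S n, S (Suc n), d n)" for n
    using t(2)[of n] by (cases "t n"; cases "t (Suc n)") (simp add: Q_def S_def d_def)
  have "free_resolution R M S d e"
    unfolding free_resolution_def
  proof (intro conjI allI)
    have S0: "S 0 = S0" and d0: "d 0 ` carrier (?F (S (Suc 0))) = {c \<in> carrier (?F (S 0)). e c = \<zero>\<^bsub>M\<^esub>}"
      using t(1)[of 0] by (simp_all add: t_eq P_def)
    show "linear_map R (?F (S 0)) M e" "e ` carrier (?F (S 0)) = carrier M"
      using e unfolding S0 by simp_all
    show "d 0 ` carrier (?F (S 1)) = {c \<in> carrier (?F (S 0)). e c = \<zero>\<^bsub>M\<^esub>}"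
      using d0 by simp
    show "linear_map R (?F (S (Suc n))) (?F (S n)) (d n)" for n
      using t(1)[of n] by (simp add: t_eq P_def)
    show "d (Suc n) ` carrier (?F (S (Suc (Suc n)))) =
        {c \<in> carrier (?F (S (Suc n))). d n c = \<zero>\<^bsub>?F (S n)\<^esub>}" for n
      using t(2)[of n] by (simp add: t_eq Q_def)
  qed
  then show ?thesis by blast
qed

section \<open>Vanishing of Ext over self-injective rings\<close>

text \<open>Linear maps from submodules of \<open>M\<close> into \<open>R\<close> extend to \<open>M\<close>. If this holds for all modules, then
  \<open>R\<close> is injective as a module over itself; the quantification over \<open>M\<close> has to stay outside since
  its elements may have any type.\<close>

definition self_injective_on :: "('r, 'a) ring_scheme \<Rightarrow> ('r, 'm) module \<Rightarrow> bool" where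
  "self_injective_on R M \<longleftrightarrow>
    (\<forall>L f. submodule L R M \<and> linear_map R (M\<lparr>carrier := L\<rparr>) (self_module R) f \<longrightarrow>
      (\<exists>g. linear_map R M (self_module R) g \<and> (\<forall>x\<in>L. g x = f x)))"

lemma (in comm_group) trivial_group_self_quotient:
  assumes "subgroup Z G"
  shows "trivial_group (G\<lparr>carrier := Z\<rparr> Mod Z)"
proof -
  interpret Z: group "G\<lparr>carrier := Z\<rparr>"
    by (rule subgroup.subgroup_is_group[OF assms is_group])
  have "Z \<lhd> G\<lparr>carrier := Z\<rparr>"
    using Z.normal_self by simp
  then have grp: "group (G\<lparr>carrier := Z\<rparr> Mod Z)"
    by (rule normal.factorgroup_is_group)
  have "carrier (G\<lparr>carrier := Z\<rparr> Mod Z) \<subseteq> {Z}"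
    using Z.coset_join2[OF _ Z.subgroup_self] by (auto simp: FactGroup_def RCOSETS_def)
  then show ?thesis
    unfolding group.trivial_group_alt[OF grp] by blast
qed

text \<open>The underlying records may differ in type beyond carrier, multiplication and unit.\<close>

lemma FactGroup_cong:
  assumes "carrier G = carrier H" "monoid.mult G = monoid.mult H"
  shows "G Mod N = H Mod N"
proof -
  have "set_mult G = set_mult H"
    using assms(2) by (intro ext) (simp add: set_mult_def)
  then show ?thesis
    using assms by (simp add: FactGroup_def RCOSETS_def r_coset_def)
qed

lemma Ext_coboundary_hom:
  assumes "module R N" "\<And>j. linear_map R (free_module R (S (Suc j))) (free_module R (S j)) (d j)"
  shows "group_hom (add_monoid (Hom_module R (free_module R (S k)) N))
    (add_monoid (Hom_module R (free_module R (S (Suc k))) N)) (Ext_coboundary R S d k)"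
proof -
  interpret N: module R N by fact
  let ?H = "\<lambda>j. Hom_module R (free_module R (S j)) N"
  interpret F: module R "free_module R (S j)" for j
    by (rule module_free_module[OF N.R.is_cring])
  interpret H: module R "?H j" for j
    by (rule module_Hom_module[OF F.module_axioms N.module_axioms])
  note [simp] = assms(2)[THEN linear_map_closed] assms(2)[THEN linear_map_add]
    assms(2)[THEN linear_map_smult] linear_map_closed linear_map_add linear_map_smult
  have "Ext_coboundary R S d k \<in> hom (add_monoid (?H k)) (add_monoid (?H (Suc k)))"
  proof (rule homI)
    fix f assume "f \<in> carrier (add_monoid (?H k))"
    then show "Ext_coboundary R S d k f \<in> carrier (add_monoid (?H (Suc k)))"
      by (auto simp: Ext_coboundary_def Hom_module_simps intro!: linear_mapI)
  next
    fix f g assume "f \<in> carrier (add_monoid (?H k))" "g \<in> carrier (add_monoid (?H k))"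
    then show "Ext_coboundary R S d k (f \<otimes>\<^bsub>add_monoid (?H k)\<^esub> g) =
        Ext_coboundary R S d k f \<otimes>\<^bsub>add_monoid (?H (Suc k))\<^esub> Ext_coboundary R S d k g"
      by (auto simp: Ext_coboundary_def Hom_module_simps fun_eq_iff)
  qed
  then show ?thesis
    by (intro group_hom.intro group_hom_axioms.intro H.a_group)
qed

lemma factor_through_image:
  assumes "module R A" "module R B" "module R N"
    and d: "linear_map R A B d" and f: "linear_map R A N f"
    and ker: "\<And>c. c \<in> carrier A \<Longrightarrow> d c = \<zero>\<^bsub>B\<^esub> \<Longrightarrow> f c = \<zero>\<^bsub>N\<^esub>"
  shows "\<exists>h. linear_map R (B\<lparr>carrier := d ` carrier A\<rparr>) N h \<and> (\<forall>c\<in>carrier A. h (d c) = f c)"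
proof -
  interpret A: module R A by fact
  interpret B: module R B by fact
  interpret N: module R N by fact
  define h where "h v = f (SOME c. c \<in> carrier A \<and> d c = v)" for v
  note [simp] = linear_map_closed[OF d] linear_map_closed[OF f]
  have h: "h (d c) = f c" if c: "c \<in> carrier A" for c
  proof -
    define c' where "c' = (SOME c'. c' \<in> carrier A \<and> d c' = d c)"
    have c': "c' \<in> carrier A" "d c' = d c"
      using someI[of "\<lambda>c'. c' \<in> carrier A \<and> d c' = d c" c] c unfolding c'_def by blast+
    have "d (c' \<oplus>\<^bsub>A\<^esub> \<ominus>\<^bsub>A\<^esub> c) = \<zero>\<^bsub>B\<^esub>"
      using c c' assms(1,2) d by (simp add: linear_map_add[OF d] linear_map_uminus B.r_neg)
    then have "f (c' \<oplus>\<^bsub>A\<^esub> \<ominus>\<^bsub>A\<^esub> c) = \<zero>\<^bsub>N\<^esub>"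
      using c c' by (intro ker) auto
    then have "f c' \<oplus>\<^bsub>N\<^esub> \<ominus>\<^bsub>N\<^esub> f c = \<zero>\<^bsub>N\<^esub>"
      using c c' assms(1,3) f by (simp add: linear_map_add[OF f] linear_map_uminus)
    then show ?thesis
      using c c' N.minus_equality[of "f c'" "\<ominus>\<^bsub>N\<^esub> f c"] by (simp add: h_def c'_def[symmetric])
  qed
  have "linear_map R (B\<lparr>carrier := d ` carrier A\<rparr>) N h"
    by (rule linear_mapI)
      (auto simp: h simp flip: linear_map_add[OF d] linear_map_smult[OF d],
       auto simp: h linear_map_add[OF f] linear_map_smult[OF f])
  with h show ?thesis by blast
qed

lemma submodule_image:
  assumes "module R A" "module R B" and d: "linear_map R A B d"
  shows "submodule (d ` carrier A) R B"
proof -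
  interpret A: module R A by fact
  interpret B: module R B by fact
  show ?thesis
    using assms(1,2) linear_map_zero[OF assms] linear_map_closed[OF d]
    by (intro B.submoduleI)
      (auto simp flip: linear_map_uminus[OF assms] linear_map_zero[OF assms] linear_map_add[OF d] linear_map_smult[OF d])
qed

text \<open>A cocycle vanishes on the kernel of the preceding differential, hence factors through its image;
  extending the factorisation to the whole free module exhibits it as a coboundary.\<close>

lemma Ext_of_resolution_trivial:
  assumes res: "free_resolution R M S d e" and cring: "cring R"
    and inj: "\<And>j. self_injective_on R (free_module R (S j))"
  shows "trivial_group (Ext_of_resolution R S d (Suc k) (self_module R))"
proof -
  let ?F = "\<lambda>j. free_module R (S j)"
  let ?H = "\<lambda>j. Hom_module R (?F j) (self_module R)"
  have lin: "linear_map R (?F (Suc j)) (?F j) (d j)"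
    and exact: "d (Suc j) ` carrier (?F (Suc (Suc j))) = {c \<in> carrier (?F (Suc j)). d j c = \<zero>\<^bsub>?F j\<^esub>}" for j
    using res by (auto simp: free_resolution_def)
  note N = module_self_module[OF cring]
  note F = module_free_module[OF cring]
  interpret H: module R "?H j" for j
    by (rule module_Hom_module[OF F N])
  interpret hom: group_hom "add_monoid (?H j)" "add_monoid (?H (Suc j))" "Ext_coboundary R S d j" for j
    by (rule Ext_coboundary_hom[OF N]) (rule lin)
  define Z where "Z = {f \<in> carrier (?H (Suc k)). Ext_coboundary R S d (Suc k) f = \<zero>\<^bsub>?H (Suc (Suc k))\<^esub>}"
  have Z: "subgroup Z (add_monoid (?H (Suc k)))"
    using hom.subgroup_kernel[of "Suc k"] by (simp add: Z_def kernel_def)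
  have "Z = Ext_coboundary R S d k ` carrier (?H k)"
  proof
    show "Ext_coboundary R S d k ` carrier (?H k) \<subseteq> Z"
    proof clarify
      fix f assume f: "f \<in> carrier (?H k)"
      have "f (d k (d (Suc k) c)) = \<zero>\<^bsub>R\<^esub>" if "c \<in> carrier (?F (Suc (Suc k)))" for c
      proof -
        have "d k (d (Suc k) c) = \<zero>\<^bsub>?F k\<^esub>" using exact[of k] that by blast
        then show ?thesis using f linear_map_zero[OF F N] by (auto simp: Hom_module_simps)
      qed
      then show "Ext_coboundary R S d k f \<in> Z"
        using hom.hom_closed[of f k] f linear_map_closed[OF lin]
        by (auto simp: Z_def Ext_coboundary_def Hom_module_simps fun_eq_iff)
    qed
    show "Z \<subseteq> Ext_coboundary R S d k ` carrier (?H k)"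
    proof
      fix f assume f: "f \<in> Z"
      then have flin: "linear_map R (?F (Suc k)) (self_module R) f"
        and fext: "f \<in> extensional (carrier (?F (Suc k)))"
        by (auto simp: Z_def Hom_module_simps)
      have "f c = \<zero>\<^bsub>self_module R\<^esub>" if "c \<in> carrier (?F (Suc k))" "d k c = \<zero>\<^bsub>?F k\<^esub>" for c
      proof -
        obtain b where b: "b \<in> carrier (?F (Suc (Suc k)))" "c = d (Suc k) b"
          using exact[of k] \<open>c \<in> _\<close> \<open>d k c = _\<close> by blast
        have "Ext_coboundary R S d (Suc k) f b = \<zero>\<^bsub>?H (Suc (Suc k))\<^esub> b"
          using f by (simp add: Z_def)
        then show ?thesis using b by (simp add: Ext_coboundary_def Hom_module_simps)
      qed
      then obtain h where h: "linear_map R ((?F k)\<lparr>carrier := d k ` carrier (?F (Suc k))\<rparr>) (self_module R) h"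
        "\<And>c. c \<in> carrier (?F (Suc k)) \<Longrightarrow> h (d k c) = f c"
        using factor_through_image[OF F F N lin flin] by blast
      then obtain g where g: "linear_map R (?F k) (self_module R) g"
        "\<And>c. c \<in> carrier (?F (Suc k)) \<Longrightarrow> g (d k c) = h (d k c)"
        using inj[of k, unfolded self_injective_on_def, rule_format, OF conjI[OF submodule_image[OF F F lin] h(1)]]
        by (metis imageI)
      have "restrict g (carrier (?F k)) \<in> carrier (?H k)"
        using g(1) module.axioms(1)[OF F]
        by (auto simp: Hom_module_simps linear_map_def module.smult_closed[OF F] abelian_monoid.a_closed[OF abelian_group.axioms(1)[OF module.axioms(2)[OF F]]])
      moreover have "f = Ext_coboundary R S d k (restrict g (carrier (?F k)))"
      proof
        show "f c = Ext_coboundary R S d k (restrict g (carrier (?F k))) c" for c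
          using g(2) h(2) linear_map_closed[OF lin] fext
          by (cases "c \<in> carrier (?F (Suc k))") (auto simp: Ext_coboundary_def extensional_def)
      qed
      ultimately show "f \<in> Ext_coboundary R S d k ` carrier (?H k)" by blast
    qed
  qed
  then have "Ext_of_resolution R S d (Suc k) (self_module R) = (add_monoid (?H (Suc k)))\<lparr>carrier := Z\<rparr> Mod Z"
    by (simp add: Ext_of_resolution_def Let_def Z_def) (rule FactGroup_cong; simp)
  then show ?thesis
    using comm_group.trivial_group_self_quotient[OF H.a_comm_group Z] by simp
qed

lemma Ext_trivial:
  fixes M :: "('r, 'm) module"
  assumes "module R M" "finite (carrier M)" "finite (carrier R)"
    and inj: "\<And>S :: ('m + 'r) list set. self_injective_on R (free_module R S)"
    and "i \<ge> 1"
  shows "trivial_group (Ext R i M (self_module R))"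
proof -
  interpret M: module R M by fact
  have "\<exists>S d e. free_resolution R M (S :: nat \<Rightarrow> ('m + 'r) list set) d e"
    by (rule ex_free_resolution[OF assms(1-3) infinite_UNIV_listI])
  then have "\<exists>Sd. case Sd of (S, d) \<Rightarrow> \<exists>e. free_resolution R M (S :: nat \<Rightarrow> ('m + 'r) list set) d e"
    by auto
  from someI_ex[OF this]
  obtain S d e where Sd: "(SOME (S, d). \<exists>e. free_resolution R M (S :: nat \<Rightarrow> ('m + 'r) list set) d e) = (S, d)"
    and res: "free_resolution R M S d e"
    by (auto split: prod.splits)
  obtain k where "i = Suc k" using \<open>i \<ge> 1\<close> by (cases i) auto
  then show ?thesis
    using Ext_of_resolution_trivial[OF res M.R.is_cring inj] by (simp add: Ext_def Sd)
qed

section \<open>Complexes with a single isomorphism\<close>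

text \<open>A complex concentrated in degrees 0 and 1 whose only differential is bijective is acyclic.\<close>

lemma acyclic_complex_single_iso:
  assumes "\<And>j. module R (obj T j)"
    and diff_linear: "\<And>j. linear_map R (obj T (Suc j)) (obj T j) (diff T j)"
    and zero: "\<And>j. carrier (obj T (Suc (Suc j))) = {\<zero>\<^bsub>obj T (Suc (Suc j))\<^esub>}"
    and iso: "bij_betw (diff T 0) (carrier (obj T 1)) (carrier (obj T 0))"
  shows "acyclic_complex R T"
proof -
  interpret Obj: module R "obj T j" for j by fact
  have diff_zero: "diff T j \<zero>\<^bsub>obj T (Suc j)\<^esub> = \<zero>\<^bsub>obj T j\<^esub>" for j
    by (rule linear_map_zero[OF assms(1,1) diff_linear])
  have "{x \<in> carrier (obj T (Suc j)). diff T j x = \<zero>\<^bsub>obj T j\<^esub>} = {\<zero>\<^bsub>obj T (Suc j)\<^esub>}" for j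
  proof (cases j)
    case 0
    have "x = \<zero>\<^bsub>obj T 1\<^esub>" if "x \<in> carrier (obj T 1)" "diff T 0 x = \<zero>\<^bsub>obj T 0\<^esub>" for x
      using inj_onD[OF bij_betw_imp_inj_on[OF iso], of x "\<zero>\<^bsub>obj T 1\<^esub>"] diff_zero[of 0] that by simp
    then show ?thesis using diff_zero[of 0] by (auto simp: 0)
  next
    case (Suc i)
    then show ?thesis using zero[of i] diff_zero[of j] by auto
  qed
  then show ?thesis
    unfolding acyclic_complex_def complex_of_R_modules_def
    using assms diff_zero bij_betw_imp_surj_on[OF iso] by auto
qed

lemma module_trivial_carrier:
  assumes "module R M"
  shows "module R (M\<lparr>carrier := {\<zero>\<^bsub>M\<^esub>}\<rparr>)"
proof -
  interpret module R M by fact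
  have "submodule {\<zero>\<^bsub>M\<^esub>} R M"
    by (rule submoduleI) auto
  then show ?thesis
    using submodule.submodule_is_module assms by blast
qed

lemma acyclic_identity_complex:
  assumes "module R M"
  shows "acyclic_complex R (identity_complex M)"
proof -
  interpret module R M by fact
  show ?thesis
    by (rule acyclic_complex_single_iso)
      (use assms module_trivial_carrier[OF assms] in
        \<open>auto simp: identity_complex_def linear_map_def bij_betw_def\<close>)
qed

section \<open>Tensor products\<close>

text \<open>The part of the module axioms needed to make the relators of a tensor product elements of the
  free abelian group on pairs. The Frobenius twist \<open>frobenius_module p n R\<close> satisfies it over every
  commutative ring, whereas it is a module only if the \<open>p\<^sup>n\<close>-th power map is additive.\<close>

definition closed_operations :: "('r, 'a) ring_scheme \<Rightarrow> ('r, 'm) module \<Rightarrow> bool" where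
  "closed_operations R M \<longleftrightarrow>
    (\<forall>x\<in>carrier M. \<forall>y\<in>carrier M. x \<oplus>\<^bsub>M\<^esub> y \<in> carrier M) \<and>
    (\<forall>r\<in>carrier R. \<forall>x\<in>carrier M. r \<odot>\<^bsub>M\<^esub> x \<in> carrier M)"

text \<open>The class in \<open>M \<otimes> N\<close> of a formal sum of pairs.\<close>

definition tensor_class ::
    "('r, 'a) ring_scheme \<Rightarrow> ('r, 'm) module \<Rightarrow> ('r, 'n) module \<Rightarrow> ('m \<times> 'n \<Rightarrow>\<^sub>0 int) \<Rightarrow>
     ('m \<times> 'n \<Rightarrow>\<^sub>0 int) set" where
  "tensor_class R M N c = tensor_relations R M N #>\<^bsub>free_Abelian_group (carrier M \<times> carrier N)\<^esub> c"

text \<open>The map \<open>(x, y) \<mapsto> (f x, g y)\<close>, extended to formal sums of pairs.\<close>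

definition pair_map :: "('m \<Rightarrow> 'm') \<Rightarrow> ('n \<Rightarrow> 'n') \<Rightarrow> ('m \<times> 'n \<Rightarrow>\<^sub>0 int) \<Rightarrow> ('m' \<times> 'n' \<Rightarrow>\<^sub>0 int)" where
  "pair_map f g = frag_extend (\<lambda>(x, y). frag_of (f x, g y))"

lemma pair_map_simps [simp]:
  "pair_map f g 0 = 0" "pair_map f g (frag_of (x, y)) = frag_of (f x, g y)"
  "pair_map f g (- c) = - pair_map f g c"
  "pair_map f g (b + c) = pair_map f g b + pair_map f g c"
  "pair_map f g (b - c) = pair_map f g b - pair_map f g c"
  by (simp_all add: pair_map_def frag_extend_minus frag_extend_add frag_extend_diff)

lemma closed_operations_module: "module R M \<Longrightarrow> closed_operations R M"
proof -
  assume "module R M"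
  then interpret module R M .
  show ?thesis by (simp add: closed_operations_def)
qed

lemma tensor_relators_subset:
  assumes "closed_operations R M" "closed_operations R N"
  shows "tensor_relators R M N \<subseteq> carrier (free_Abelian_group (carrier M \<times> carrier N))"
proof -
  let ?G = "free_Abelian_group (carrier M \<times> carrier N)"
  have diff: "a - b \<in> carrier ?G" if "a \<in> carrier ?G" "b \<in> carrier ?G" for a b
    using that keys_diff[of a b] by auto
  show ?thesis
    unfolding tensor_relators_def
    using assms unfolding closed_operations_def
    by (auto intro!: diff simp del: carrier_free_Abelian_group_iff)
qed

lemma subgroup_tensor_relations:
  assumes "closed_operations R M" "closed_operations R N"
  shows "subgroup (tensor_relations R M N) (free_Abelian_group (carrier M \<times> carrier N))"
  unfolding tensor_relations_def
  by (rule group.generate_is_subgroup[OF group_free_Abelian_group tensor_relators_subset[OF assms]])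

lemma tensor_relations_diff:
  assumes "closed_operations R M" "closed_operations R N"
    and "a \<in> tensor_relations R M N" "b \<in> tensor_relations R M N"
  shows "a - b \<in> tensor_relations R M N"
proof -
  note sub = subgroup_tensor_relations[OF assms(1,2)]
  have "Poly_Mapping.keys b \<subseteq> carrier M \<times> carrier N"
    using subsetD[OF subgroup.subset[OF sub] assms(4)] by simp
  then show ?thesis
    using subgroup.m_closed[OF sub assms(3) subgroup.m_inv_closed[OF sub assms(4)]] by simp
qed

lemma tensor_relations_zero:
  assumes "closed_operations R M" "closed_operations R N"
  shows "0 \<in> tensor_relations R M N"
  using subgroup.one_closed[OF subgroup_tensor_relations[OF assms]] by simp

lemma tensor_relators_imp_relations: "a \<in> tensor_relators R M N \<Longrightarrow> a \<in> tensor_relations R M N"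
  unfolding tensor_relations_def by (rule generate.incl)

lemma tensor_class_eqI:
  assumes "closed_operations R M" "closed_operations R N" "a - b \<in> tensor_relations R M N"
  shows "tensor_class R M N a = tensor_class R M N b"
proof -
  have sub: "tensor_class R M N a \<subseteq> tensor_class R M N b" if ab: "a - b \<in> tensor_relations R M N" for a b
  proof
    fix c assume "c \<in> tensor_class R M N a"
    then obtain h where h: "h \<in> tensor_relations R M N" "c = h + a"
      by (auto simp: tensor_class_def r_coset_def)
    then have "h - (0 - (a - b)) \<in> tensor_relations R M N"
      by (intro tensor_relations_diff[OF assms(1,2)] tensor_relations_zero[OF assms(1,2)] ab)
    then show "c \<in> tensor_class R M N b"
      unfolding tensor_class_def r_coset_def using h(2) by (auto intro!: bexI[of _ "h - (0 - (a - b))"])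
  qed
  have "b - a \<in> tensor_relations R M N"
    using tensor_relations_diff[OF assms(1,2) tensor_relations_zero[OF assms(1,2)] assms(3)] by simp
  then show ?thesis
    using sub assms(3) by blast
qed

lemma comm_group_tensor_group:
  assumes "closed_operations R M" "closed_operations R N"
  shows "comm_group (tensor_group R M N)"
  unfolding tensor_group_def
  by (rule comm_group.abelian_FactGroup[OF abelian_free_Abelian_group subgroup_tensor_relations[OF assms]])

lemma carrier_tensor_group:
  "carrier (tensor_group R M N) =
    tensor_class R M N ` carrier (free_Abelian_group (carrier M \<times> carrier N))"
  by (auto simp: tensor_group_def FactGroup_def RCOSETS_def tensor_class_def)

lemma one_tensor_group:
  assumes "closed_operations R M" "closed_operations R N"
  shows "\<one>\<^bsub>tensor_group R M N\<^esub> = tensor_class R M N 0"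
  using group.coset_mult_one[OF group_free_Abelian_group subgroup.subset[OF subgroup_tensor_relations[OF assms]]]
  by (simp add: tensor_group_def FactGroup_def tensor_class_def)

lemma tensor_class_mult:
  assumes "closed_operations R M" "closed_operations R N"
    and "Poly_Mapping.keys a \<subseteq> carrier M \<times> carrier N" "Poly_Mapping.keys b \<subseteq> carrier M \<times> carrier N"
  shows "tensor_class R M N a \<otimes>\<^bsub>tensor_group R M N\<^esub> tensor_class R M N b = tensor_class R M N (a + b)"
proof -
  have "tensor_relations R M N \<lhd> free_Abelian_group (carrier M \<times> carrier N)"
    by (rule comm_group.subgroup_imp_normal[OF abelian_free_Abelian_group subgroup_tensor_relations[OF assms(1,2)]])
  then show ?thesis
    using normal.rcos_sum[of "tensor_relations R M N" "free_Abelian_group (carrier M \<times> carrier N)" a b] assms(3,4)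
    by (simp add: tensor_group_def FactGroup_def tensor_class_def)
qed

lemma keys_pair_map:
  assumes "Poly_Mapping.keys c \<subseteq> carrier M \<times> carrier N"
    and "f \<in> carrier M \<rightarrow> carrier M'" "g \<in> carrier N \<rightarrow> carrier N'"
  shows "Poly_Mapping.keys (pair_map f g c) \<subseteq> carrier M' \<times> carrier N'"
  using assms keys_frag_extend[of "\<lambda>(x, y). frag_of (f x, g y)" c]
  by (fastforce simp: Pi_iff pair_map_def)

lemma tensor_relatorsI:
  "x \<in> carrier M \<Longrightarrow> x' \<in> carrier M \<Longrightarrow> y \<in> carrier N \<Longrightarrow>
    frag_of (x \<oplus>\<^bsub>M\<^esub> x', y) - frag_of (x, y) - frag_of (x', y) \<in> tensor_relators R M N"
  "x \<in> carrier M \<Longrightarrow> y \<in> carrier N \<Longrightarrow> y' \<in> carrier N \<Longrightarrow>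
    frag_of (x, y \<oplus>\<^bsub>N\<^esub> y') - frag_of (x, y) - frag_of (x, y') \<in> tensor_relators R M N"
  "r \<in> carrier R \<Longrightarrow> x \<in> carrier M \<Longrightarrow> y \<in> carrier N \<Longrightarrow>
    frag_of (r \<odot>\<^bsub>M\<^esub> x, y) - frag_of (x, r \<odot>\<^bsub>N\<^esub> y) \<in> tensor_relators R M N"
  unfolding tensor_relators_def by blast+

lemma pair_map_relators:
  assumes f: "linear_map R M M' f" and g: "linear_map R N N' g" and c: "c \<in> tensor_relators R M N"
  shows "pair_map f g c \<in> tensor_relators R M' N'"
proof -
  note fg = linear_map_closed[OF f] linear_map_closed[OF g] linear_map_add[OF f] linear_map_add[OF g]
    linear_map_smult[OF f] linear_map_smult[OF g]
  show ?thesis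
    using c unfolding tensor_relators_def[of R M N]
    by (auto simp: fg intro!: tensor_relatorsI)
qed

lemma pair_map_relations:
  assumes ops: "closed_operations R M" "closed_operations R N" "closed_operations R M'" "closed_operations R N'"
    and f: "linear_map R M M' f" and g: "linear_map R N N' g" and c: "c \<in> tensor_relations R M N"
  shows "pair_map f g c \<in> tensor_relations R M' N'"
proof -
  interpret G: group "free_Abelian_group (carrier M \<times> carrier N)" by simp
  show ?thesis
    using c unfolding tensor_relations_def[of R M N]
  proof (induction rule: generate.induct)
    case one
    show ?case using tensor_relations_zero[OF ops(3,4)] by simp
  next
    case (incl h)
    then show ?case
      by (intro tensor_relators_imp_relations pair_map_relators[OF f g])
  next
    case (inv h)
    then have "Poly_Mapping.keys h \<subseteq> carrier M \<times> carrier N"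
      using subsetD[OF tensor_relators_subset[OF ops(1,2)]] by simp
    moreover have "0 - pair_map f g h \<in> tensor_relations R M' N'"
      using inv by (intro tensor_relations_diff[OF ops(3,4)] tensor_relations_zero[OF ops(3,4)]
          tensor_relators_imp_relations pair_map_relators[OF f g])
    ultimately show ?case by simp
  next
    case (eng h1 h2)
    have "pair_map f g h1 - (0 - pair_map f g h2) \<in> tensor_relations R M' N'"
      using eng by (intro tensor_relations_diff[OF ops(3,4)] tensor_relations_zero[OF ops(3,4)])
    then show ?case by simp
  qed
qed

lemma tensor_map_class:
  assumes ops: "closed_operations R M" "closed_operations R N" "closed_operations R M'" "closed_operations R N'"
    and f: "linear_map R M M' f" and g: "linear_map R N N' g"
  shows "tensor_map R M' N' f g (tensor_class R M N c) = tensor_class R M' N' (pair_map f g c)"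
proof -
  have "tensor_class R M' N' (pair_map f g b) = tensor_class R M' N' (pair_map f g c)"
    if b: "b \<in> tensor_class R M N c" for b
  proof (rule tensor_class_eqI[OF ops(3,4)])
    obtain h where "h \<in> tensor_relations R M N" "b = h + c"
      using b by (auto simp: tensor_class_def r_coset_def)
    then show "pair_map f g b - pair_map f g c \<in> tensor_relations R M' N'"
      using pair_map_relations[OF ops f g] by (simp flip: pair_map_simps)
  qed
  moreover have "c \<in> tensor_class R M N c"
    using tensor_relations_zero[OF ops(1,2)] by (force simp: tensor_class_def r_coset_def)
  ultimately show ?thesis
    unfolding tensor_map_def tensor_class_def pair_map_def by blast
qed

lemma pair_map_cong:
  assumes "Poly_Mapping.keys c \<subseteq> carrier M \<times> carrier N"
    and "\<And>x y. x \<in> carrier M \<Longrightarrow> y \<in> carrier N \<Longrightarrow> f x = f' x \<and> g y = g' y"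
  shows "pair_map f g c = pair_map f' g' c"
  unfolding pair_map_def using assms by (intro frag_extend_eq) auto

lemma pair_map_compose: "pair_map f g (pair_map f' g' c) = pair_map (f \<circ> f') (g \<circ> g') c"
proof -
  have "pair_map f g (frag_extend (frag_of \<circ> (\<lambda>(x, y). (f' x, g' y))) c) =
      frag_extend ((\<lambda>(x, y). frag_of (f x, g y)) \<circ> (\<lambda>(x, y). (f' x, g' y))) c"
    unfolding pair_map_def by (rule frag_extend_compose)
  then show ?thesis
    by (simp add: pair_map_def comp_def case_prod_unfold)
qed

lemma pair_map_id: "pair_map id id c = c"
  using frag_expansion[of c] by (simp add: pair_map_def case_prod_unfold)

section \<open>The Frobenius functor\<close>

lemma frobenius_module_simps [simp]:
  "carrier (frobenius_module p n R) = carrier R" "x \<oplus>\<^bsub>frobenius_module p n R\<^esub> y = x \<oplus>\<^bsub>R\<^esub> y"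
  "r \<odot>\<^bsub>frobenius_module p n R\<^esub> x = (r [^]\<^bsub>R\<^esub> (p ^ n)) \<otimes>\<^bsub>R\<^esub> x"
  by (simp_all add: frobenius_module_def)

lemma closed_operations_frobenius_module: "cring R \<Longrightarrow> closed_operations R (frobenius_module p n R)"
proof -
  assume "cring R"
  then interpret cring R .
  show ?thesis by (simp add: closed_operations_def)
qed

lemma linear_map_frobenius_module_mult:
  assumes "cring R" "r \<in> carrier R"
  shows "linear_map R (frobenius_module p n R) (frobenius_module p n R) (\<lambda>s. r \<otimes>\<^bsub>R\<^esub> s)"
proof -
  interpret cring R by fact
  show ?thesis using assms(2) by (intro linear_mapI) (auto simp: r_distr m_lcomm)
qed

lemma linear_map_id: "linear_map R M M id"
  by (simp add: linear_map_def)

lemma frobenius_functor_simps: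
  "carrier (frobenius_functor p n R M) = carrier (tensor_group R M (frobenius_module p n R))"
  "\<zero>\<^bsub>frobenius_functor p n R M\<^esub> = \<one>\<^bsub>tensor_group R M (frobenius_module p n R)\<^esub>"
  "s \<oplus>\<^bsub>frobenius_functor p n R M\<^esub> t = s \<otimes>\<^bsub>tensor_group R M (frobenius_module p n R)\<^esub> t"
  "r \<odot>\<^bsub>frobenius_functor p n R M\<^esub> t =
    tensor_map R M (frobenius_module p n R) id (\<lambda>s. r \<otimes>\<^bsub>R\<^esub> s) t"
  by (simp_all add: frobenius_functor_def Let_def)

lemma frobenius_functor_cases:
  assumes "t \<in> carrier (frobenius_functor p n R M)"
  obtains c where "Poly_Mapping.keys c \<subseteq> carrier M \<times> carrier R"
    "t = tensor_class R M (frobenius_module p n R) c"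
  using assms by (auto simp: frobenius_functor_simps carrier_tensor_group)

lemma frobenius_functor_class_closed:
  "Poly_Mapping.keys c \<subseteq> carrier M \<times> carrier R \<Longrightarrow>
    tensor_class R M (frobenius_module p n R) c \<in> carrier (frobenius_functor p n R M)"
  by (simp add: frobenius_functor_simps carrier_tensor_group)

lemma frobenius_functor_class_add:
  assumes "module R M"
    and "Poly_Mapping.keys a \<subseteq> carrier M \<times> carrier R" "Poly_Mapping.keys b \<subseteq> carrier M \<times> carrier R"
  shows "tensor_class R M (frobenius_module p n R) a \<oplus>\<^bsub>frobenius_functor p n R M\<^esub>
      tensor_class R M (frobenius_module p n R) b = tensor_class R M (frobenius_module p n R) (a + b)"
  using assms module.axioms(1)[OF assms(1)]
  by (simp add: frobenius_functor_simps tensor_class_mult closed_operations_module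
      closed_operations_frobenius_module)

lemma frobenius_functor_class_smult:
  assumes "module R M" "r \<in> carrier R"
  shows "r \<odot>\<^bsub>frobenius_functor p n R M\<^esub> tensor_class R M (frobenius_module p n R) c =
      tensor_class R M (frobenius_module p n R) (pair_map id (\<lambda>s. r \<otimes>\<^bsub>R\<^esub> s) c)"
proof -
  note R = module.axioms(1)[OF assms(1)]
  show ?thesis
    unfolding frobenius_functor_simps
    by (rule tensor_map_class[OF closed_operations_module[OF assms(1)] closed_operations_frobenius_module[OF R]
          closed_operations_module[OF assms(1)] closed_operations_frobenius_module[OF R]
          linear_map_id linear_map_frobenius_module_mult[OF R assms(2)]])
qed

lemma frobenius_functor_class_map:
  assumes "module R M" "module R M'" "linear_map R M M' f"
  shows "tensor_map R M' (frobenius_module p n R) f id (tensor_class R M (frobenius_module p n R) c) =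
      tensor_class R M' (frobenius_module p n R) (pair_map f id c)"
proof -
  note R = module.axioms(1)[OF assms(1)]
  show ?thesis
    by (rule tensor_map_class[OF closed_operations_module[OF assms(1)] closed_operations_frobenius_module[OF R]
          closed_operations_module[OF assms(2)] closed_operations_frobenius_module[OF R] assms(3) linear_map_id])
qed

lemma abelian_group_frobenius_functor:
  assumes "module R M"
  shows "abelian_group (frobenius_functor p n R M)"
proof -
  interpret M: module R M by fact
  interpret T: comm_group "tensor_group R M (frobenius_module p n R)"
    by (rule comm_group_tensor_group[OF closed_operations_module[OF assms]
          closed_operations_frobenius_module[OF M.R.is_cring]])
  show ?thesis
    by (rule abelian_groupI) (auto simp: frobenius_functor_simps T.m_ac intro: T.l_inv_ex)
qed

lemma module_frobenius_functor:
  assumes "module R M"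
  shows "module R (frobenius_functor p n R M)"
proof -
  interpret M: module R M by fact
  let ?N = "frobenius_module p n R" and ?F = "frobenius_functor p n R M"
  let ?cl = "tensor_class R M ?N"
  note ops = closed_operations_module[OF assms] closed_operations_frobenius_module[OF M.R.is_cring, of p n]
  note smult = frobenius_functor_class_smult[OF assms]
  note add = frobenius_functor_class_add[OF assms]
  have keys: "Poly_Mapping.keys (pair_map id (\<lambda>s. r \<otimes>\<^bsub>R\<^esub> s) c) \<subseteq> carrier M \<times> carrier R"
    if "r \<in> carrier R" "Poly_Mapping.keys c \<subseteq> carrier M \<times> carrier R" for r and c :: "_ \<Rightarrow>\<^sub>0 int"
    using that keys_pair_map[of c M "self_module R" id M "\<lambda>s. r \<otimes>\<^bsub>R\<^esub> s" "self_module R"] by auto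
  show ?thesis
  proof (rule moduleI)
    show "cring R" by (rule M.R.is_cring)
    show "abelian_group ?F" by (rule abelian_group_frobenius_functor[OF assms])
  next
    fix r t assume r: "r \<in> carrier R" and t: "t \<in> carrier ?F"
    then show "r \<odot>\<^bsub>?F\<^esub> t \<in> carrier ?F"
      by (elim frobenius_functor_cases) (simp add: smult keys frobenius_functor_class_closed)
    fix s assume s: "s \<in> carrier R"
    obtain c where c: "Poly_Mapping.keys c \<subseteq> carrier M \<times> carrier R" "t = ?cl c"
      using t by (rule frobenius_functor_cases)
    have "pair_map id (\<lambda>u. (r \<oplus>\<^bsub>R\<^esub> s) \<otimes>\<^bsub>R\<^esub> u) c -
        (pair_map id (\<lambda>u. r \<otimes>\<^bsub>R\<^esub> u) c + pair_map id (\<lambda>u. s \<otimes>\<^bsub>R\<^esub> u) c) \<in> tensor_relations R M ?N"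
      using c(1)
    proof (induction c rule: frag_induction)
      case zero
      show ?case using tensor_relations_zero[OF ops] by simp
    next
      case (one z)
      then obtain x u where z: "z = (x, u)" "x \<in> carrier M" "u \<in> carrier R" by auto
      have "frag_of (x, r \<otimes>\<^bsub>R\<^esub> u \<oplus>\<^bsub>?N\<^esub> s \<otimes>\<^bsub>R\<^esub> u) - frag_of (x, r \<otimes>\<^bsub>R\<^esub> u) - frag_of (x, s \<otimes>\<^bsub>R\<^esub> u)
          \<in> tensor_relations R M ?N"
        using r s z by (intro tensor_relators_imp_relations tensor_relatorsI) auto
      then show ?case using r s z by (simp add: M.l_distr algebra_simps)
    next
      case (diff a b)
      then show ?case
        using tensor_relations_diff[OF ops diff] by (simp add: algebra_simps)
    qed
    then show "(r \<oplus>\<^bsub>R\<^esub> s) \<odot>\<^bsub>?F\<^esub> t = r \<odot>\<^bsub>?F\<^esub> t \<oplus>\<^bsub>?F\<^esub> s \<odot>\<^bsub>?F\<^esub> t"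
      using r s c by (simp add: smult add keys tensor_class_eqI[OF ops])
    have "pair_map id (\<lambda>u. (r \<otimes>\<^bsub>R\<^esub> s) \<otimes>\<^bsub>R\<^esub> u) c =
        pair_map id (\<lambda>u. r \<otimes>\<^bsub>R\<^esub> u) (pair_map id (\<lambda>u. s \<otimes>\<^bsub>R\<^esub> u) c)"
      unfolding pair_map_compose using r s c(1)
      by (intro pair_map_cong[where M = M and N = "self_module R"]) (auto simp: M.m_assoc)
    then show "(r \<otimes>\<^bsub>R\<^esub> s) \<odot>\<^bsub>?F\<^esub> t = r \<odot>\<^bsub>?F\<^esub> (s \<odot>\<^bsub>?F\<^esub> t)"
      using r s c(2) by (simp add: smult)
  next
    fix r t t' assume r: "r \<in> carrier R" and "t \<in> carrier ?F" "t' \<in> carrier ?F"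
    then obtain c c' where "Poly_Mapping.keys c \<subseteq> carrier M \<times> carrier R" "t = ?cl c"
      "Poly_Mapping.keys c' \<subseteq> carrier M \<times> carrier R" "t' = ?cl c'"
      by (metis frobenius_functor_cases)
    then show "r \<odot>\<^bsub>?F\<^esub> (t \<oplus>\<^bsub>?F\<^esub> t') = r \<odot>\<^bsub>?F\<^esub> t \<oplus>\<^bsub>?F\<^esub> r \<odot>\<^bsub>?F\<^esub> t'"
      using r by (simp add: smult add keys)
  next
    fix t assume "t \<in> carrier ?F"
    then obtain c where c: "Poly_Mapping.keys c \<subseteq> carrier M \<times> carrier R" "t = ?cl c"
      by (rule frobenius_functor_cases)
    have "pair_map id (\<lambda>u. \<one>\<^bsub>R\<^esub> \<otimes>\<^bsub>R\<^esub> u) c = pair_map id id c"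
      using c(1) by (intro pair_map_cong[where M = M and N = "self_module R"]) auto
    then show "\<one>\<^bsub>R\<^esub> \<odot>\<^bsub>?F\<^esub> t = t"
      using c(2) by (simp add: smult pair_map_id)
  qed
qed

lemma linear_map_frobenius_functor:
  assumes "module R M" "module R M'" and f: "linear_map R M M' f"
  shows "linear_map R (frobenius_functor p n R M) (frobenius_functor p n R M')
    (tensor_map R M' (frobenius_module p n R) f id)"
proof -
  interpret M: module R M by fact
  note simps = frobenius_functor_class_map[OF assms] frobenius_functor_class_smult[OF assms(1)]
    frobenius_functor_class_smult[OF assms(2)] frobenius_functor_class_add[OF assms(1)]
    frobenius_functor_class_add[OF assms(2)]
  have keys: "Poly_Mapping.keys (pair_map f id c) \<subseteq> carrier M' \<times> carrier R"
    if "Poly_Mapping.keys c \<subseteq> carrier M \<times> carrier R" for c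
    using that keys_pair_map[of c M "self_module R" f M' id "self_module R"] linear_map_closed[OF f] by auto
  show ?thesis
  proof (rule linear_mapI)
    fix s t assume "s \<in> carrier (frobenius_functor p n R M)" "t \<in> carrier (frobenius_functor p n R M)"
    then obtain a b where "Poly_Mapping.keys a \<subseteq> carrier M \<times> carrier R" "s = tensor_class R M (frobenius_module p n R) a"
      "Poly_Mapping.keys b \<subseteq> carrier M \<times> carrier R" "t = tensor_class R M (frobenius_module p n R) b"
      by (metis frobenius_functor_cases)
    then show "tensor_map R M' (frobenius_module p n R) f id s \<in> carrier (frobenius_functor p n R M')"
      "tensor_map R M' (frobenius_module p n R) f id (s \<oplus>\<^bsub>frobenius_functor p n R M\<^esub> t) =
        tensor_map R M' (frobenius_module p n R) f id s \<oplus>\<^bsub>frobenius_functor p n R M'\<^esub>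
        tensor_map R M' (frobenius_module p n R) f id t"
      by (simp_all add: simps keys frobenius_functor_class_closed)
  next
    fix r t assume "r \<in> carrier R" "t \<in> carrier (frobenius_functor p n R M)"
    then show "tensor_map R M' (frobenius_module p n R) f id (r \<odot>\<^bsub>frobenius_functor p n R M\<^esub> t) =
        r \<odot>\<^bsub>frobenius_functor p n R M'\<^esub> tensor_map R M' (frobenius_module p n R) f id t"
      by (elim frobenius_functor_cases) (simp add: simps pair_map_compose)
  qed
qed

lemma frobenius_functor_trivial:
  assumes "module R M" "carrier M = {\<zero>\<^bsub>M\<^esub>}"
  shows "carrier (frobenius_functor p n R M) = {\<zero>\<^bsub>frobenius_functor p n R M\<^esub>}"
proof -
  interpret M: module R M by fact
  let ?N = "frobenius_module p n R"
  note ops = closed_operations_module[OF assms(1)] closed_operations_frobenius_module[OF M.R.is_cring, of p n]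
  have "c \<in> tensor_relations R M ?N" if "Poly_Mapping.keys c \<subseteq> carrier M \<times> carrier R" for c
    using that
  proof (induction c rule: frag_induction)
    case (one z)
    then obtain u where z: "z = (\<zero>\<^bsub>M\<^esub>, u)" "u \<in> carrier R" using assms(2) by auto
    have "frag_of (\<zero>\<^bsub>M\<^esub> \<oplus>\<^bsub>M\<^esub> \<zero>\<^bsub>M\<^esub>, u) - frag_of (\<zero>\<^bsub>M\<^esub>, u) - frag_of (\<zero>\<^bsub>M\<^esub>, u) \<in> tensor_relations R M ?N"
      using z by (intro tensor_relators_imp_relations tensor_relatorsI) auto
    then have "0 - frag_of z \<in> tensor_relations R M ?N"
      by (simp add: z)
    from tensor_relations_diff[OF ops tensor_relations_zero[OF ops] this] show ?case
      by simp
  qed (auto intro: tensor_relations_diff[OF ops] tensor_relations_zero[OF ops])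
  then have "tensor_class R M ?N c = tensor_class R M ?N 0" if "Poly_Mapping.keys c \<subseteq> carrier M \<times> carrier R" for c
    using that by (intro tensor_class_eqI[OF ops]) simp
  moreover have "\<zero>\<^bsub>frobenius_functor p n R M\<^esub> = tensor_class R M ?N 0"
    using one_tensor_group[OF ops] by (simp add: frobenius_functor_simps)
  moreover have "tensor_class R M ?N 0 \<in> carrier (frobenius_functor p n R M)"
    by (rule frobenius_functor_class_closed) simp
  ultimately have zero: "\<zero>\<^bsub>frobenius_functor p n R M\<^esub> \<in> carrier (frobenius_functor p n R M)"
    and eq: "tensor_class R M ?N c = \<zero>\<^bsub>frobenius_functor p n R M\<^esub>"
      if "Poly_Mapping.keys c \<subseteq> carrier M \<times> carrier R" for c
    using that by metis+
  show ?thesis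
  proof (intro equalityI subsetI)
    fix t assume "t \<in> carrier (frobenius_functor p n R M)"
    then show "t \<in> {\<zero>\<^bsub>frobenius_functor p n R M\<^esub>}"
      by (rule frobenius_functor_cases) (simp only: eq singleton_iff)
  qed (use zero[of 0] in simp)
qed

lemma acyclic_frobenius_identity_complex:
  assumes "module R M"
  shows "acyclic_complex R (frobenius_complex p n R (identity_complex M))"
proof -
  let ?T = "identity_complex M"
  have mod: "module R (obj ?T j)" for j
    using assms module_trivial_carrier[OF assms] by (simp add: identity_complex_def)
  have diff_linear: "linear_map R (obj ?T (Suc j)) (obj ?T j) (diff ?T j)" for j
    using acyclic_identity_complex[OF assms] by (simp add: acyclic_complex_def complex_of_R_modules_def)
  show ?thesis
  proof (rule acyclic_complex_single_iso)
    show "module R (obj (frobenius_complex p n R ?T) j)" for j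
      using module_frobenius_functor[OF mod] by (simp add: frobenius_complex_def)
    show "linear_map R (obj (frobenius_complex p n R ?T) (Suc j)) (obj (frobenius_complex p n R ?T) j)
        (diff (frobenius_complex p n R ?T) j)" for j
      using linear_map_frobenius_functor[OF mod mod diff_linear] by (simp add: frobenius_complex_def)
    show "carrier (obj (frobenius_complex p n R ?T) (Suc (Suc j))) =
        {\<zero>\<^bsub>obj (frobenius_complex p n R ?T) (Suc (Suc j))\<^esub>}" for j
      using frobenius_functor_trivial[OF mod, of "Suc (Suc j)"]
      by (simp add: frobenius_complex_def identity_complex_def)
    have "tensor_map R M (frobenius_module p n R) id id t = t" if "t \<in> carrier (frobenius_functor p n R M)" for t
      using that by (elim frobenius_functor_cases)
        (simp add: frobenius_functor_class_map[OF assms assms linear_map_id] pair_map_id)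
    then have "bij_betw (tensor_map R M (frobenius_module p n R) id id)
        (carrier (frobenius_functor p n R M)) (carrier (frobenius_functor p n R M))"
      by (simp add: bij_betw_def inj_on_def)
    then show "bij_betw (diff (frobenius_complex p n R ?T) 0)
        (carrier (obj (frobenius_complex p n R ?T) 1)) (carrier (obj (frobenius_complex p n R ?T) 0))"
      by (simp add: frobenius_complex_def identity_complex_def id_def)
  qed
qed

section \<open>Self-injectivity of the ring\<close>

text \<open>Extension of \<open>\<F>\<^sub>2\<close>-valued additive functions. For \<open>f \<noteq> 0\<close>, Zorn's lemma yields a subgroup \<open>H\<close> containing the kernel
  of \<open>f\<close> and maximal among those avoiding some \<open>e\<close> with \<open>f e = 1\<close>; it has index 2, and the extension is
  the characteristic function of its complement.\<close>

lemma (in abelian_group) additive_extension: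
  fixes f :: "'a \<Rightarrow> bit"
  assumes exp2: "\<And>v. v \<in> carrier G \<Longrightarrow> v \<oplus> v = \<zero>"
    and L: "L \<subseteq> carrier G" "\<And>v w. v \<in> L \<Longrightarrow> w \<in> L \<Longrightarrow> v \<oplus> w \<in> L"
    and f: "\<And>v w. v \<in> L \<Longrightarrow> w \<in> L \<Longrightarrow> f (v \<oplus> w) = f v + f w"
  shows "\<exists>g. (\<forall>v\<in>carrier G. \<forall>w\<in>carrier G. g (v \<oplus> w) = g v + g w) \<and> (\<forall>v\<in>L. g v = f v)"
proof (cases "\<forall>v\<in>L. f v = 0")
  case True
  then show ?thesis by (intro exI[of _ "\<lambda>_. 0"]) auto
next
  case False
  then obtain e where e: "e \<in> L" "f e = 1" by auto
  have eG: "e \<in> carrier G" using e L by blast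
  have cancel: "v \<oplus> (v \<oplus> w) = w" if "v \<in> carrier G" "w \<in> carrier G" for v w
    using that by (simp flip: a_assoc add: exp2)
  \<comment> \<open>In exponent 2 a nonempty subset closed under addition is a subgroup.\<close>
  define closed where "closed H \<longleftrightarrow> H \<subseteq> carrier G \<and> (\<forall>v\<in>H. \<forall>w\<in>H. v \<oplus> w \<in> H)" for H
  define fam where "fam = {H. closed H \<and> {v \<in> L. f v = 0} \<subseteq> H \<and> e \<notin> H}"
  have "\<exists>H\<in>fam. \<forall>K\<in>fam. (H \<subseteq> K \<longrightarrow> K = H)"
  proof (rule subset_Zorn_nonempty)
    have "{v \<in> L. f v = 0} \<in> fam" using L f e by (auto simp: fam_def closed_def)
    then show "fam \<noteq> {}" by blast
  next
    fix C assume "C \<noteq> {}" and C: "subset.chain fam C"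
    have "v \<oplus> w \<in> \<Union>C" if "v \<in> K" "w \<in> K'" "K \<in> C" "K' \<in> C" for v w K K'
    proof -
      have "K \<subseteq> K' \<or> K' \<subseteq> K" "closed K" "closed K'"
        using C that by (auto simp: subset_chain_def fam_def)
      then show ?thesis using that unfolding closed_def by blast
    qed
    then have "closed (\<Union>C)"
      using C unfolding subset_chain_def fam_def closed_def by (auto 0 3)
    moreover obtain K where "K \<in> C" using \<open>C \<noteq> {}\<close> by blast
    moreover have "C \<subseteq> fam" using C by (simp add: subset_chain_def)
    ultimately show "\<Union>C \<in> fam"
      unfolding fam_def by blast
  qed
  then obtain H where H: "H \<in> fam" and max: "\<And>K. K \<in> fam \<Longrightarrow> H \<subseteq> K \<Longrightarrow> K = H" by blast
  from H have HG: "H \<subseteq> carrier G" and H_add: "\<And>v w. v \<in> H \<Longrightarrow> w \<in> H \<Longrightarrow> v \<oplus> w \<in> H"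
    and H_ker: "\<And>v. v \<in> L \<Longrightarrow> f v = 0 \<Longrightarrow> v \<in> H" and eH: "e \<notin> H"
    by (auto simp: fam_def closed_def)
  have "f (e \<oplus> e) = 0" using f[OF e(1) e(1)] by simp
  then have zeroH: "\<zero> \<in> H" using H_ker[of "e \<oplus> e"] L(2)[OF e(1) e(1)] exp2[OF eG] by simp
  have flip: "v \<oplus> e \<in> H" if v: "v \<in> carrier G" "v \<notin> H" for v
  proof (rule ccontr)
    assume "v \<oplus> e \<notin> H"
    define K where "K = H \<union> (\<lambda>h. v \<oplus> h) ` H"
    have "closed K"
      unfolding closed_def
    proof (intro conjI ballI)
      show "K \<subseteq> carrier G" using v(1) HG by (auto simp: K_def)
      have sums: "(v \<oplus> h) \<oplus> (v \<oplus> h') = h \<oplus> h'" "h \<oplus> (v \<oplus> h') = v \<oplus> (h \<oplus> h')"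
        "(v \<oplus> h) \<oplus> h' = v \<oplus> (h \<oplus> h')" if "h \<in> H" "h' \<in> H" for h h'
        using v that HG by (auto simp: a_ac cancel exp2 subset_iff)
      fix a b assume "a \<in> K" "b \<in> K"
      then consider "a \<in> H" "b \<in> H" | h where "h \<in> H" "a = v \<oplus> h" "b \<in> H"
        | h' where "a \<in> H" "h' \<in> H" "b = v \<oplus> h'"
        | h h' where "h \<in> H" "a = v \<oplus> h" "h' \<in> H" "b = v \<oplus> h'"
        unfolding K_def by blast
      then show "a \<oplus> b \<in> K"
        unfolding K_def by cases (simp_all only: sums, (blast intro: H_add)+)
    qed
    moreover have "e \<noteq> v \<oplus> h" if "h \<in> H" for h
      using cancel[of v h] \<open>v \<oplus> e \<notin> H\<close> that HG v by auto
    ultimately have "K \<in> fam" using H eH by (auto simp: fam_def K_def)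
    then have "K = H" by (rule max) (auto simp: K_def)
    moreover have "v \<in> K" using zeroH v(1) by (force simp: K_def)
    ultimately show False using v(2) by simp
  qed
  define g where "g v = (if v \<in> H then 0 else 1 :: bit)" for v
  have "g (v \<oplus> w) = g v + g w" if vw: "v \<in> carrier G" "w \<in> carrier G" for v w
  proof -
    have *: "v \<oplus> w \<notin> H" if "v \<in> H" "w \<notin> H" "w \<in> carrier G" for v w
      using H_add[of v "v \<oplus> w"] that HG cancel[of v w] by auto
    have "v \<oplus> w \<in> H" if "v \<notin> H" "w \<notin> H"
    proof -
      have "(v \<oplus> e) \<oplus> (w \<oplus> e) = v \<oplus> w"
        using vw eG cancel[of e "v \<oplus> w"] by (simp add: a_ac)
      then show ?thesis using H_add[OF flip flip] vw that by metis
    qed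
    then show ?thesis
      using H_add[of v w] *[of v w] *[of w v] vw by (auto simp: g_def a_comm)
  qed
  moreover have "g v = f v" if v: "v \<in> L" for v
  proof (cases "f v = 0")
    case True
    then show ?thesis using H_ker[OF v] by (simp add: g_def)
  next
    case False
    then have "f (v \<oplus> e) = 0" using f[OF v e(1)] e(2) by simp
    then have "v \<oplus> e \<in> H" using H_ker L(2)[OF v e(1)] by blast
    then have "v \<notin> H"
      using H_add[of v "v \<oplus> e"] cancel[of v e] eG eH v L(1) by auto
    then show ?thesis using False by (simp add: g_def)
  qed
  ultimately show ?thesis by blast
qed

lemma R22_module_add_self:
  assumes "module R22 M" "v \<in> carrier M"
  shows "v \<oplus>\<^bsub>M\<^esub> v = \<zero>\<^bsub>M\<^esub>"
proof -
  interpret module R22 M by fact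
  have "(\<one>\<^bsub>R22\<^esub> \<oplus>\<^bsub>R22\<^esub> \<one>\<^bsub>R22\<^esub>) \<odot>\<^bsub>M\<^esub> v = \<zero>\<^bsub>R22\<^esub> \<odot>\<^bsub>M\<^esub> v"
    by (simp add: one_R22 zero_R22)
  then show ?thesis using assms(2) by (simp add: smult_l_distr)
qed

text \<open>The additive function \<open>socle_coeff \<circ> f\<close> extends to some \<open>g\<close>; the four coordinates of the extension
  of \<open>f\<close> at \<open>v\<close> must then be \<open>g (x y v)\<close>, \<open>g (y v)\<close>, \<open>g (x v)\<close> and \<open>g v\<close>, and these formulas do define a
  linear map.\<close>

lemma R22_self_injective:
  assumes "module R22 M"
  shows "self_injective_on R22 M"
  unfolding self_injective_on_def
proof (intro allI impI, elim conjE)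
  interpret M: module R22 M by fact
  fix L f assume L: "submodule L R22 M"
    and f: "linear_map R22 (M\<lparr>carrier := L\<rparr>) (self_module R22) f"
  note sub = M.submoduleE[OF L]
  have f_add: "f (v \<oplus>\<^bsub>M\<^esub> w) = f v \<oplus>\<^bsub>R22\<^esub> f w" if "v \<in> L" "w \<in> L" for v w
    using linear_map_add[OF f, of v w] that by simp
  have f_smult: "f (r \<odot>\<^bsub>M\<^esub> v) = r \<otimes>\<^bsub>R22\<^esub> f v" if "r \<in> carrier R22" "v \<in> L" for r v
    using linear_map_smult[OF f, of r v] that by simp
  have f_closed: "f v \<in> carrier R22" if "v \<in> L" for v
    using linear_map_closed[OF f, of v] that by simp
  have socle_add: "socle_coeff (f (v \<oplus>\<^bsub>M\<^esub> w)) = socle_coeff (f v) + socle_coeff (f w)" if "v \<in> L" "w \<in> L" for v w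
    using f_closed[OF that(1)] f_closed[OF that(2)] f_add[OF that]
    by (auto elim!: R22_cases)
  obtain g where g_add: "\<And>v w. v \<in> carrier M \<Longrightarrow> w \<in> carrier M \<Longrightarrow> g (v \<oplus>\<^bsub>M\<^esub> w) = g v + g w"
    and g_eq: "\<And>v. v \<in> L \<Longrightarrow> g v = socle_coeff (f v)"
    using M.additive_extension[of L "\<lambda>v. socle_coeff (f v)", OF R22_module_add_self[OF assms] sub(1,5) socle_add]
    by metis
  have g_zero: "g \<zero>\<^bsub>M\<^esub> = 0"
    using g_add[of "\<zero>\<^bsub>M\<^esub>" "\<zero>\<^bsub>M\<^esub>"] by simp
  define gx gy gxy where "gx v = g (el 0 1 0 0 \<odot>\<^bsub>M\<^esub> v)" and "gy v = g (el 0 0 1 0 \<odot>\<^bsub>M\<^esub> v)"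
    and "gxy v = g (el 0 0 0 1 \<odot>\<^bsub>M\<^esub> v)" for v
  have g_smult: "g (el a b c d \<odot>\<^bsub>M\<^esub> v) = a * g v + b * gx v + c * gy v + d * gxy v"
    if v: "v \<in> carrier M" for a b c d v
  proof -
    have "el a b c d = el a 0 0 0 \<oplus>\<^bsub>R22\<^esub> el 0 b 0 0 \<oplus>\<^bsub>R22\<^esub> el 0 0 c 0 \<oplus>\<^bsub>R22\<^esub> el 0 0 0 d"
      by simp
    then have "g (el a b c d \<odot>\<^bsub>M\<^esub> v) = g (el a 0 0 0 \<odot>\<^bsub>M\<^esub> v) + g (el 0 b 0 0 \<odot>\<^bsub>M\<^esub> v) +
        g (el 0 0 c 0 \<odot>\<^bsub>M\<^esub> v) + g (el 0 0 0 d \<odot>\<^bsub>M\<^esub> v)"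
      using v by (simp only: M.smult_l_distr M.R.a_closed M.smult_closed M.a_closed g_add el_closed)
    moreover have "el 0 0 0 0 \<odot>\<^bsub>M\<^esub> v = \<zero>\<^bsub>M\<^esub>" "el 1 0 0 0 \<odot>\<^bsub>M\<^esub> v = v"
      using v by (simp_all flip: zero_R22 one_R22)
    ultimately show ?thesis
      by (cases a; cases b; cases c; cases d) (simp_all add: g_zero gx_def gy_def gxy_def)
  qed
  define h where "h v = el (gxy v) (gy v) (gx v) (g v)" for v
  have "linear_map R22 M (self_module R22) h"
  proof (rule linear_mapI)
    fix v assume v: "v \<in> carrier M"
    show "h v \<in> carrier (self_module R22)" by (simp add: h_def)
    fix w assume "w \<in> carrier M"
    with v show "h (v \<oplus>\<^bsub>M\<^esub> w) = h v \<oplus>\<^bsub>self_module R22\<^esub> h w"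
      by (simp add: h_def gx_def gy_def gxy_def M.smult_r_distr g_add)
  next
    fix r v assume r: "r \<in> carrier R22" and v: "v \<in> carrier M"
    obtain a b c d where r_eq: "r = el a b c d" using r by (rule R22_cases)
    have "s \<odot>\<^bsub>M\<^esub> (r \<odot>\<^bsub>M\<^esub> v) = (s \<otimes>\<^bsub>R22\<^esub> r) \<odot>\<^bsub>M\<^esub> v" if "s \<in> carrier R22" for s
      using that r v by (simp add: M.smult_assoc1)
    then have "gx (r \<odot>\<^bsub>M\<^esub> v) = g (el 0 a 0 c \<odot>\<^bsub>M\<^esub> v)" "gy (r \<odot>\<^bsub>M\<^esub> v) = g (el 0 0 a b \<odot>\<^bsub>M\<^esub> v)"
      "gxy (r \<odot>\<^bsub>M\<^esub> v) = g (el 0 0 0 a \<odot>\<^bsub>M\<^esub> v)"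
      by (simp_all add: gx_def gy_def gxy_def r_eq)
    then show "h (r \<odot>\<^bsub>M\<^esub> v) = r \<odot>\<^bsub>self_module R22\<^esub> h v"
      by (simp add: h_def r_eq g_smult[OF v] ac_simps)
  qed
  moreover have "h v = f v" if v: "v \<in> L" for v
  proof -
    obtain a b c d where fv: "f v = el a b c d" using f_closed[OF v] by (rule R22_cases)
    show ?thesis
      using v sub(4) by (simp add: h_def gx_def gy_def gxy_def g_eq f_smult fv)
  qed
  ultimately show "\<exists>h. linear_map R22 M (self_module R22) h \<and> (\<forall>v\<in>L. h v = f v)" by blast
qed

lemma Ext_R22_trivial:
  assumes "module R22 M" "finite (carrier M)" "i \<ge> 1"
  shows "trivial_group (Ext R22 i M (self_module R22))"
  by (rule Ext_trivial[OF assms(1,2) finite_carrier_R22 _ assms(3)])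
    (intro R22_self_injective module_free_module cring_R22)

section \<open>Reflexivity of the maximal ideal\<close>

text \<open>The biduality map is linear for every module; only its bijectivity depends on the module.\<close>

lemma linear_map_biduality:
  assumes "module R M"
  shows "linear_map R M (dual_module R (dual_module R M)) (biduality_map R M)"
proof -
  interpret M: module R M by fact
  have dual: "f \<in> carrier (dual_module R M) \<longleftrightarrow> f \<in> extensional (carrier M) \<and> linear_map R M (self_module R) f" for f
    by (simp add: dual_module_def Hom_module_simps)
  interpret D: module R "dual_module R M"
    unfolding dual_module_def by (intro module_Hom_module assms module_self_module M.R.is_cring)
  show ?thesis
  proof (rule linear_mapI)
    fix v assume v: "v \<in> carrier M"
    have "linear_map R (dual_module R M) (self_module R) (biduality_map R M v)"
    proof (rule linear_mapI)
      fix f assume f: "f \<in> carrier (dual_module R M)"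
      then show "biduality_map R M v f \<in> carrier (self_module R)"
        using v linear_map_closed[of R M "self_module R" f v] by (simp add: biduality_map_def dual)
      fix g assume "g \<in> carrier (dual_module R M)"
      with f show "biduality_map R M v (f \<oplus>\<^bsub>dual_module R M\<^esub> g) =
          biduality_map R M v f \<oplus>\<^bsub>self_module R\<^esub> biduality_map R M v g"
        using v D.a_closed[of f g] by (simp add: biduality_map_def) (simp add: dual_module_def Hom_module_simps)
    next
      fix r f assume "r \<in> carrier R" "f \<in> carrier (dual_module R M)"
      then show "biduality_map R M v (r \<odot>\<^bsub>dual_module R M\<^esub> f) = r \<odot>\<^bsub>self_module R\<^esub> biduality_map R M v f"
        using v D.smult_closed[of r f] by (simp add: biduality_map_def) (simp add: dual_module_def Hom_module_simps)
    qed
    then show "biduality_map R M v \<in> carrier (dual_module R (dual_module R M))"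
      unfolding dual_module_def[of R "dual_module R M"]
      by (simp add: Hom_module_simps) (simp add: biduality_map_def)
    fix w assume "w \<in> carrier M"
    with v show "biduality_map R M (v \<oplus>\<^bsub>M\<^esub> w) =
        biduality_map R M v \<oplus>\<^bsub>dual_module R (dual_module R M)\<^esub> biduality_map R M w"
      unfolding dual_module_def[of R "dual_module R M"]
      by (auto simp: Hom_module_simps biduality_map_def dual fun_eq_iff linear_map_add)
  next
    fix r v assume "r \<in> carrier R" "v \<in> carrier M"
    then show "biduality_map R M (r \<odot>\<^bsub>M\<^esub> v) = r \<odot>\<^bsub>dual_module R (dual_module R M)\<^esub> biduality_map R M v"
      unfolding dual_module_def[of R "dual_module R M"]
      by (auto simp: Hom_module_simps biduality_map_def dual fun_eq_iff linear_map_smult)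
  qed
qed

text \<open>By self-injectivity the functional extends to the whole ring, where it is multiplication by its
  value at 1.\<close>

lemma ideal_functional_is_multiplication:
  assumes "ideal I R22" "linear_map R22 (ideal_module R22 I) (self_module R22) f"
  shows "\<exists>r\<in>carrier R22. \<forall>u\<in>I. f u = r \<otimes>\<^bsub>R22\<^esub> u"
proof -
  interpret cring R22 by (rule cring_R22)
  interpret I: ideal I R22 by fact
  interpret S: module R22 "self_module R22" by (rule module_self_module[OF cring_R22])
  have eq: "(self_module R22)\<lparr>carrier := I\<rparr> = ideal_module R22 I"
    by (simp add: self_module_def ideal_module_def)
  have "submodule I R22 (self_module R22)"
    using S.module_incl_imp_submodule[of I] I.a_subset module_ideal_module[OF cring_R22 assms(1)]
    by (simp add: eq)
  then obtain g where g: "linear_map R22 (self_module R22) (self_module R22) g" "\<And>u. u \<in> I \<Longrightarrow> g u = f u"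
    using R22_self_injective[OF S.module_axioms] assms(2) unfolding self_injective_on_def eq[symmetric]
    by metis
  have "g u = g \<one>\<^bsub>R22\<^esub> \<otimes>\<^bsub>R22\<^esub> u" if "u \<in> carrier R22" for u
    using linear_map_smult[OF g(1), of u "\<one>\<^bsub>R22\<^esub>"] linear_map_closed[OF g(1), of "\<one>\<^bsub>R22\<^esub>"] that
    by (simp add: m_comm)
  moreover have "g \<one>\<^bsub>R22\<^esub> \<in> carrier R22"
    using linear_map_closed[OF g(1), of "\<one>\<^bsub>R22\<^esub>"] by simp
  ultimately show ?thesis
    using g(2) I.a_subset by (metis subsetD)
qed

lemma ideal_max_ideal: "ideal max_ideal R22"
proof -
  interpret cring R22 by (rule cring_R22)
  show ?thesis by (rule genideal_ideal) (auto simp: res_x_eq res_y_eq)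
qed

lemma annihilator_of_socle:
  assumes "u \<in> carrier R22"
  shows "el 0 0 0 1 \<otimes>\<^bsub>R22\<^esub> u = \<zero>\<^bsub>R22\<^esub> \<longleftrightarrow> u \<in> max_ideal"
  using assms by (elim R22_cases) (simp add: zero_R22 ideal_generated_by_x_y)

text \<open>Stated for all modules isomorphic to the maximal ideal because \<open>G_dim\<close> asks for resolutions whose
  terms live on another type. With \<open>k\<close> the isomorphism back to the ideal, the dual is generated by
  the inclusion \<open>\<iota>\<close> given by \<open>k\<close>. Hence an element \<open>\<phi>\<close> of the bidual is determined by \<open>\<phi> \<iota>\<close>, and since
  \<open>x y \<iota> = 0\<close> this value is annihilated by \<open>x y\<close>, so it lies in the ideal: \<open>\<phi>\<close> is evaluation at a point.\<close>

lemma totally_reflexive_if_iso_max_ideal: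
  assumes M: "module R22 M" and h: "module_iso R22 (ideal_module R22 max_ideal) M h"
  shows "totally_reflexive R22 M"
proof -
  interpret R: cring R22 by (rule cring_R22)
  interpret M: module R22 M by fact
  let ?D = "dual_module R22 M" and ?DD = "dual_module R22 (dual_module R22 M)"
  have car: "carrier (ideal_module R22 max_ideal) = max_ideal"
    by (simp add: ideal_module_def)
  have sub: "max_ideal \<subseteq> carrier R22"
    using ideal_generated_by_x_y by auto
  have h_lin: "linear_map R22 (ideal_module R22 max_ideal) M h" and bij: "bij_betw h max_ideal (carrier M)"
    using h by (simp_all add: module_iso_def car)
  define k where "k = inv_into max_ideal h"
  have k_closed: "k v \<in> max_ideal" and h_k: "h (k v) = v" if "v \<in> carrier M" for v
    using that bij by (auto simp: k_def bij_betw_def inv_into_into f_inv_into_f)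
  have k_h: "k (h u) = u" if "u \<in> max_ideal" for u
    using that bij by (simp add: k_def bij_betw_def)
  have h_closed: "h u \<in> carrier M" if "u \<in> max_ideal" for u
    using that bij by (auto simp: bij_betw_def)
  interpret I: ideal max_ideal R22 by (rule ideal_max_ideal)
  have k_lin: "linear_map R22 M (self_module R22) k"
  proof (rule linear_mapI)
    fix v assume v: "v \<in> carrier M"
    show "k v \<in> carrier (self_module R22)" using k_closed[OF v] sub by auto
    fix w assume w: "w \<in> carrier M"
    have "h (k v \<oplus>\<^bsub>R22\<^esub> k w) = v \<oplus>\<^bsub>M\<^esub> w"
      using linear_map_add[OF h_lin, of "k v" "k w"] k_closed v w by (simp add: car h_k) (simp add: ideal_module_def)
    then have "k (v \<oplus>\<^bsub>M\<^esub> w) = k v \<oplus>\<^bsub>R22\<^esub> k w"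
      using k_h[of "k v \<oplus>\<^bsub>R22\<^esub> k w"] k_closed[OF v] k_closed[OF w] I.a_closed by simp
    then show "k (v \<oplus>\<^bsub>M\<^esub> w) = k v \<oplus>\<^bsub>self_module R22\<^esub> k w" by simp
  next
    fix r v assume r: "r \<in> carrier R22" and v: "v \<in> carrier M"
    have "h (r \<otimes>\<^bsub>R22\<^esub> k v) = r \<odot>\<^bsub>M\<^esub> v"
      using linear_map_smult[OF h_lin, of r "k v"] k_closed r v by (simp add: car h_k) (simp add: ideal_module_def)
    then have "k (r \<odot>\<^bsub>M\<^esub> v) = r \<otimes>\<^bsub>R22\<^esub> k v"
      using k_h[of "r \<otimes>\<^bsub>R22\<^esub> k v"] k_closed[OF v] I.I_l_closed r by simp
    then show "k (r \<odot>\<^bsub>M\<^esub> v) = r \<odot>\<^bsub>self_module R22\<^esub> k v" by simp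
  qed
  define \<iota> where "\<iota> = restrict k (carrier M)"
  interpret D: module R22 ?D
    unfolding dual_module_def by (intro module_Hom_module M module_self_module cring_R22)
  interpret DD: module R22 ?DD
    unfolding dual_module_def[of R22 ?D] by (intro module_Hom_module D.module_axioms module_self_module cring_R22)
  have dual: "f \<in> carrier ?D \<longleftrightarrow> f \<in> extensional (carrier M) \<and> linear_map R22 M (self_module R22) f" for f
    by (simp add: dual_module_def Hom_module_simps)
  have smult: "r \<odot>\<^bsub>?D\<^esub> \<iota> = (\<lambda>v\<in>carrier M. r \<otimes>\<^bsub>R22\<^esub> k v)" for r
    by (auto simp: dual_module_def Hom_module_simps \<iota>_def fun_eq_iff)
  have \<iota>: "\<iota> \<in> carrier ?D"
    using k_lin by (auto simp: dual \<iota>_def linear_map_def)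
  have gen: "\<exists>r\<in>carrier R22. f = r \<odot>\<^bsub>?D\<^esub> \<iota>" if f: "f \<in> carrier ?D" for f
  proof -
    have "linear_map R22 (ideal_module R22 max_ideal) (self_module R22) (f \<circ> h)"
      using f h_lin unfolding linear_map_def dual by (auto simp: Pi_iff)
    then obtain r where r: "r \<in> carrier R22" "\<And>u. u \<in> max_ideal \<Longrightarrow> f (h u) = r \<otimes>\<^bsub>R22\<^esub> u"
      using ideal_functional_is_multiplication[OF ideal_max_ideal, of "f \<circ> h"] by (metis comp_apply)
    have "f v = r \<otimes>\<^bsub>R22\<^esub> k v" if "v \<in> carrier M" for v
      using r(2)[OF k_closed[OF that]] by (simp add: h_k that)
    then have "f = r \<odot>\<^bsub>?D\<^esub> \<iota>"
      using f by (auto simp: smult dual extensional_def fun_eq_iff)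
    then show ?thesis using r(1) by blast
  qed
  have "carrier ?D \<subseteq> (\<lambda>r. r \<odot>\<^bsub>?D\<^esub> \<iota>) ` carrier R22" using gen by blast
  then have finD: "finite (carrier ?D)"
    using finite_carrier_R22 finite_surj by blast
  have finM: "finite (carrier M)"
    using bij_betw_finite[OF bij] finite_subset[OF sub finite_carrier_R22] by simp
  have bd_lin: "linear_map R22 M ?DD (biduality_map R22 M)"
    by (rule linear_map_biduality[OF M])
  have inj: "inj_on (biduality_map R22 M) (carrier M)"
  proof (rule inj_onI)
    fix v w assume v: "v \<in> carrier M" and w: "w \<in> carrier M"
      and "biduality_map R22 M v = biduality_map R22 M w"
    then have "biduality_map R22 M v \<iota> = biduality_map R22 M w \<iota>" by simp
    then have "k v = k w" using \<iota> v w by (simp add: biduality_map_def) (simp add: \<iota>_def)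
    then have "h (k v) = h (k w)" by (rule arg_cong)
    then show "v = w" by (simp only: h_k[OF v] h_k[OF w])
  qed
  have "\<phi> \<in> biduality_map R22 M ` carrier M" if \<phi>: "\<phi> \<in> carrier ?DD" for \<phi>
  proof -
    have \<phi>_lin: "linear_map R22 ?D (self_module R22) \<phi>" and \<phi>_ext: "\<phi> \<in> extensional (carrier ?D)"
      using \<phi> unfolding dual_module_def[of R22 ?D] by (simp_all add: Hom_module_simps)
    have \<phi>\<iota>: "\<phi> \<iota> \<in> carrier R22" using linear_map_closed[OF \<phi>_lin \<iota>] by simp
    have "el 0 0 0 1 \<otimes>\<^bsub>R22\<^esub> k v = \<zero>\<^bsub>R22\<^esub>" if "v \<in> carrier M" for v
      using annihilator_of_socle k_closed[OF that] sub by blast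
    moreover have "\<zero>\<^bsub>?D\<^esub> = (\<lambda>v\<in>carrier M. \<zero>\<^bsub>R22\<^esub>)"
      by (simp add: dual_module_def Hom_module_simps)
    ultimately have "el 0 0 0 1 \<odot>\<^bsub>?D\<^esub> \<iota> = \<zero>\<^bsub>?D\<^esub>"
      by (simp add: smult restrict_def fun_eq_iff)
    then have "el 0 0 0 1 \<otimes>\<^bsub>R22\<^esub> \<phi> \<iota> = \<zero>\<^bsub>R22\<^esub>"
      using linear_map_smult[OF \<phi>_lin _ \<iota>, of "el 0 0 0 1"]
        linear_map_zero[OF D.module_axioms module_self_module[OF cring_R22] \<phi>_lin] by simp
    then have u: "\<phi> \<iota> \<in> max_ideal" using annihilator_of_socle[OF \<phi>\<iota>] by blast
    have "\<phi> f = f (h (\<phi> \<iota>))" if f: "f \<in> carrier ?D" for f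
    proof -
      obtain r where r: "r \<in> carrier R22" "f = r \<odot>\<^bsub>?D\<^esub> \<iota>" using gen[OF f] by blast
      then show ?thesis
        using linear_map_smult[OF \<phi>_lin r(1) \<iota>] h_closed[OF u] by (simp add: smult[of r] k_h[OF u])
    qed
    then have "\<phi> = biduality_map R22 M (h (\<phi> \<iota>))"
      using \<phi>_ext by (auto simp: biduality_map_def extensional_def fun_eq_iff)
    then show ?thesis using h_closed[OF u] by blast
  qed
  then have "module_iso R22 M ?DD (biduality_map R22 M)"
    unfolding module_iso_def bij_betw_def using bd_lin inj linear_map_closed[OF bd_lin] by blast
  then show ?thesis
    unfolding totally_reflexive_def
    using M Ext_R22_trivial[OF M finM] Ext_R22_trivial[OF D.module_axioms finD] by blast
qed

section \<open>The Gorenstein dimension\<close>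

text \<open>The copy of a module along a map that is injective on its carrier. The multiplicative fields of
  the record play no role.\<close>

definition transported_module :: "('m \<Rightarrow> 'n) \<Rightarrow> ('r, 'm) module \<Rightarrow> ('r, 'n) module" where
  "transported_module h M =
    (let k = inv_into (carrier M) h in
     \<lparr>carrier = h ` carrier M, monoid.mult = undefined, one = undefined,
      ring.zero = h \<zero>\<^bsub>M\<^esub>, ring.add = (\<lambda>x y. h (k x \<oplus>\<^bsub>M\<^esub> k y)),
      module.smult = (\<lambda>r x. h (r \<odot>\<^bsub>M\<^esub> k x))\<rparr>)"

lemma module_transported_module:
  assumes "module R M" "inj_on h (carrier M)"
  shows "module R (transported_module h M)"
proof -
  interpret M: module R M by fact
  have [simp]: "inv_into (carrier M) h (h x) = x" if "x \<in> carrier M" for x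
    using assms(2) that by simp
  show ?thesis
  proof (rule moduleI)
    show "abelian_group (transported_module h M)"
    proof (rule abelian_groupI)
      fix x assume "x \<in> carrier (transported_module h M)"
      then obtain v where v: "v \<in> carrier M" "x = h v"
        by (auto simp: transported_module_def Let_def)
      then show "\<exists>y\<in>carrier (transported_module h M).
          y \<oplus>\<^bsub>transported_module h M\<^esub> x = \<zero>\<^bsub>transported_module h M\<^esub>"
        by (intro bexI[of _ "h (\<ominus>\<^bsub>M\<^esub> v)"]) (auto simp: transported_module_def Let_def M.l_neg)
    qed (auto simp: transported_module_def Let_def M.a_ac)
  qed (auto simp: transported_module_def Let_def M.R.is_cring M.smult_l_distr M.smult_r_distr M.smult_assoc1)
qed

lemma module_iso_transported_module:
  assumes "module R M" "inj_on h (carrier M)"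
  shows "module_iso R M (transported_module h M) h"
    "module_iso R (transported_module h M) M (inv_into (carrier M) h)"
proof -
  interpret M: module R M by fact
  have [simp]: "inv_into (carrier M) h (h x) = x" if "x \<in> carrier M" for x
    using assms(2) that by simp
  show "module_iso R M (transported_module h M) h"
    using assms(2) by (auto simp: module_iso_def bij_betw_def linear_map_def transported_module_def Let_def)
  have "bij_betw (inv_into (carrier M) h) (h ` carrier M) (carrier M)"
    using assms(2) by (intro bij_betw_inv_into) (simp add: bij_betw_def)
  then show "module_iso R (transported_module h M) M (inv_into (carrier M) h)"
    by (auto simp: module_iso_def linear_map_def transported_module_def Let_def)
qed

lemma G_resolution_identity_complex:
  assumes "totally_reflexive R M"
  shows "G_resolution R 0 (identity_complex M)"
proof -
  have "module R M" using assms by (simp add: totally_reflexive_def)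
  then show ?thesis
    unfolding G_resolution_def using assms acyclic_identity_complex[of R M]
    by (auto simp: identity_complex_def)
qed

lemma minimal_G_resolution_max_ideal:
  "minimal_G_resolution R22 (ideal_module R22 max_ideal) (identity_complex (ideal_module R22 max_ideal))"
proof -
  let ?M = "ideal_module R22 max_ideal"
  have M: "module R22 ?M" by (rule module_ideal_module[OF cring_R22 ideal_max_ideal])
  have "module_iso R22 ?M ?M id"
    by (simp add: module_iso_def linear_map_id)
  then have refl: "totally_reflexive R22 ?M"
    by (rule totally_reflexive_if_iso_max_ideal[OF M])
  \<comment> \<open>A copy of the ideal on the list type over which \<open>G_dim\<close> ranges.\<close>
  define h where "h u = [Inl u :: bit poly poly set + bit poly poly set]" for u :: "bit poly poly set"
  have inj: "inj_on h (carrier ?M)" by (simp add: inj_on_def h_def)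
  let ?T = "identity_complex (transported_module h ?M)"
  have "totally_reflexive R22 (transported_module h ?M)"
    by (rule totally_reflexive_if_iso_max_ideal[OF module_transported_module[OF M inj]
          module_iso_transported_module(1)[OF M inj]])
  then have "G_resolution R22 0 ?T" by (rule G_resolution_identity_complex)
  moreover have "isomorphic_modules R22 (obj ?T 0) ?M"
    using module_iso_transported_module(2)[OF M inj] by (auto simp: isomorphic_modules_def identity_complex_def)
  ultimately have "G_dim R22 ?M \<le> enat 0"
    unfolding G_dim_def by (intro Inf_lower) blast
  then have "enat 0 = G_dim R22 ?M" by (simp add: zero_enat_def[symmetric])
  then show ?thesis
    unfolding minimal_G_resolution_def
    using G_resolution_identity_complex[OF refl] by (auto simp: identity_complex_def)
qed

theorem mainTheorem1:
  shows "(\<exists>D. derivation R22 D \<and>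
            (let B = maximally_differential_ideal R22 {D};
                 M = ideal_module R22 B;
                 T = identity_complex M
             in B = genideal R22 {res_x, res_y} \<and>
                totally_reflexive R22 M \<and>
                minimal_G_resolution R22 M T \<and>
                (\<forall>n\<ge>1. acyclic_complex R22 (frobenius_complex 2 n R22 T)) \<and>
                \<not> complete_intersection_ideal R22 B)) \<and>
         (\<exists>D'. derivation R22 D' \<and>
            maximally_differential_ideal R22 {D'} = genideal R22 {res_x})"
proof
  let ?M = "ideal_module R22 max_ideal"
  have M: "module R22 ?M" by (rule module_ideal_module[OF cring_R22 ideal_max_ideal])
  have "module_iso R22 ?M ?M id"
    by (simp add: module_iso_def linear_map_id)
  then have "totally_reflexive R22 ?M"
    by (rule totally_reflexive_if_iso_max_ideal[OF M])
  \<comment> \<open>Every ideal is differential for the zero derivation, so its maximally differential ideal is the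
    maximal ideal.\<close>
  then show "\<exists>D. derivation R22 D \<and>
      (let B = maximally_differential_ideal R22 {D}; M = ideal_module R22 B; T = identity_complex M
       in B = max_ideal \<and> totally_reflexive R22 M \<and> minimal_G_resolution R22 M T \<and>
          (\<forall>n\<ge>1. acyclic_complex R22 (frobenius_complex 2 n R22 T)) \<and>
          \<not> complete_intersection_ideal R22 B)"
    unfolding Let_def
    using derivation_zero[OF cring_R22] minimal_G_resolution_max_ideal not_complete_intersection
      acyclic_frobenius_identity_complex[OF M]
    by (intro exI[of _ "\<lambda>_. \<zero>\<^bsub>R22\<^esub>"]) (simp add: maximally_differential_ideal_zero)
  show "\<exists>D'. derivation R22 D' \<and> maximally_differential_ideal R22 {D'} = genideal R22 {res_x}"
    using derivation_d_dy maximally_differential_ideal_d_dy by blast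
qed

end
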